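(* Let $p,q\in(0,1)$ and $r>0$, and consider the multitype Galton--Watson branching process with typeset $\mathcal X=\mathbb N_0^2$ and the following offspring distributions: - an individual of type $(0,0)$ has one child of type $(1,0)$ with probability $q$, and no children otherwise; - an individual of type $(0,j)$, $j\ge1$, has one child of type $(0,j-1)$ with probability $p$, and no children otherwise; - an individual of type $(i,0)$, $i\ge1$, has one child of type $(i,1)$ with probability $1$, and one child of type $(i+1,0)$ with probability $q$; - an individual of type $(i,j)$, $i,j\ge1$, has a geometric number (supported on $\{0,1,2,\dots\}$) of children of type $(i-1,j)$ with mean $r^{-j+1}$, and one child of type $(i,j+1)$ with probability $1$. For $i\ge0$ let $\mathcal L_i=\{(i,j):j\ge0\}$, and for $A\subseteq\mathcal X$ let $\iota(A)=\min\{i\ge0:|\mathcal L_i\cap A|=\infty\}$, with $\iota(A)=\infty$ if this set is empty. Write $\boldsymbol q=\boldsymbol q(\mathcal X)$. Then: (i) If $r<1$, then there is a finite number $i^*:=\min\{i\ge1:r^i\le p\}$ of distinct extinction probability vectors, namely $\boldsymbol q=\tilde{\boldsymbol q}$ if $i^*=1$, and $$\boldsymbol q=\boldsymbol q(\mathcal L_1)<\dots<\boldsymbol q(\mathcal L_{i^*})=\tilde{\boldsymbol q}\quad\text{if } i^*\ge2.$$ In particular, if $\iota(A)<i^*$ then $\boldsymbol q(A)=\boldsymbol q(\mathcal L_{\iota(A)})$, whereas if $\iota(A)\ge i^*$ then $\boldsymbol q(A)=\tilde{\boldsymbol q}$. (ii) If $r=1$, then there are countably infinitely many distinct extinction probability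 vectors, namely $$\boldsymbol q=\boldsymbol q(\mathcal L_1)<\boldsymbol q(\mathcal L_2)<\boldsymbol q(\mathcal L_3)<\cdots$$ and $\tilde{\boldsymbol q}$. In particular, if $\iota(A)<\infty$ then $\boldsymbol q(A)=\boldsymbol q(\mathcal L_{\iota(A)})$, whereas if $\iota(A)=\infty$ then $\boldsymbol q(A)=\tilde{\boldsymbol q}$. (iii) If $r>1$, then there are uncountably many distinct extinction probability vectors.
   Context: In a multitype Galton--Watson branching process $\{\boldsymbol Z_n\}_{n\ge0}$ with countable typeset $\mathcal X$, $\boldsymbol Z_n=(Z_{n,x})_{x\in\mathcal X}$, $Z_{n,x}$ is the number of type-$x$ individuals in generation $n$; each individual lives for one generation and at death, independently of all others, gives birth to offspring according to the law associated with its type. Here, for a given parent, the numbers of children of different types are independent. $\mathbb P_x$ denotes the law of the process started from a single type-$x$ individual. For $A\subseteq\mathcal X$, $\mathcal E(A)$ is the event $\lim_{n\to\infty}\sum_{x\in A}Z_{n,x}=0$ (extinction in $A$); the extinction probability vectors are the vectors $\boldsymbol q(A)=(q_x(A))_{x\in\mathcal X}$, $A\subseteq\mathcal X$, with $q_x(A)=\mathbb P_x(\mathcal E(A))$; $\tilde{\boldsymbol q}=(\tilde q_x)_{x\in\mathcal X}$ with $\tilde q_x=\mathbb P_x\big(\bigcap_{A:|A|<\infty}\mathcal E(A)\big)$. For vectors, $\boldsymbol u<\boldsymbol v$ means $u_x\le v_x$ for all $x$ with strict inequality for at least one $x$. A geometric variable $\xi$ on $\{0,1,2,\dots\}$ with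 mean $m$ has $\mathbb P(\xi=k)=\frac{1}{1+m}\big(\frac{m}{1+m}\big)^k$. $\mathbb N_0=\{0,1,2,\dots\}$.
   Formalization: The sets A defining extinction probability vectors, and those in the clauses giving q(A)=q̃, are taken nonempty: for A=∅ one has q(∅)=1 and ι(∅)=∞, while for r<1 q̃ vanishes at (i*,0), so the literal claim and the count i* would fail. *)

theory Defs
  imports "HOL-Probability.Probability"
begin

section \<open>Multitype Galton--Watson processes\<close>

text \<open>
  A process is given by its offspring laws: \<open>off x\<close> is the law of the multiset of the types
  of the children of a type-\<open>x\<close> individual. The probability space carries independent litters
  \<open>\<omega> (n, y, k)\<close> with law \<open>off y\<close>: the litter of the \<open>k\<close>-th type-\<open>y\<close> individual of generation \<open>n\<close>.
  The same space serves for every initial type; the law of \<open>\<lambda>n. gw x n\<close> under it is the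
  law of the process started from one type-\<open>x\<close> individual.
\<close>

definition gw_space ::
    "('a::countable \<Rightarrow> 'a multiset pmf) \<Rightarrow> (nat \<times> 'a \<times> nat \<Rightarrow> 'a multiset) measure" where
  "gw_space off = (\<Pi>\<^sub>M (n, y, k) \<in> UNIV. measure_pmf (off y))"

primrec gw :: "'a::countable \<Rightarrow> nat \<Rightarrow> (nat \<times> 'a \<times> nat \<Rightarrow> 'a multiset) \<Rightarrow> 'a multiset" where
  "gw x 0 \<omega> = {#x#}"
| "gw x (Suc n) \<omega> = (\<Sum>y\<in>set_mset (gw x n \<omega>). \<Sum>k<count (gw x n \<omega>) y. \<omega> (n, y, k))"

text \<open>
  The number of individuals with type in \<open>A\<close> is a \<open>size\<close>, not a \<open>sum\<close> over \<open>A\<close>,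
  since \<open>sum\<close> is \<open>0\<close> on every infinite set \<open>A\<close>.
\<close>

definition extinct_in ::
    "'a::countable \<Rightarrow> 'a set \<Rightarrow> (nat \<times> 'a \<times> nat \<Rightarrow> 'a multiset) \<Rightarrow> bool" where
  "extinct_in x A \<omega> \<longleftrightarrow> (\<lambda>n. size {#y \<in># gw x n \<omega>. y \<in> A#}) \<longlonglongrightarrow> 0"

definition ext_prob :: "('a::countable \<Rightarrow> 'a multiset pmf) \<Rightarrow> 'a set \<Rightarrow> 'a \<Rightarrow> real" where
  "ext_prob off A x = measure (gw_space off) {\<omega> \<in> space (gw_space off). extinct_in x A \<omega>}"

definition partial_ext_prob :: "('a::countable \<Rightarrow> 'a multiset pmf) \<Rightarrow> 'a \<Rightarrow> real" where
  "partial_ext_prob off x =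
     measure (gw_space off) {\<omega> \<in> space (gw_space off). \<forall>A. finite A \<longrightarrow> extinct_in x A \<omega>}"

text \<open>
  The empty set of types is left out: extinction in \<open>{}\<close> is certain, so it contributes only the
  constant vector \<open>1\<close>, which is not counted among the extinction probability vectors.
\<close>

definition ext_vectors :: "('a::countable \<Rightarrow> 'a multiset pmf) \<Rightarrow> ('a \<Rightarrow> real) set" where
  "ext_vectors off = {ext_prob off A | A. A \<noteq> {}}"

section \<open>The process on \<open>nat \<times> nat\<close>\<close>

definition geometric_mean_pmf :: "real \<Rightarrow> nat pmf" where
  "geometric_mean_pmf m = geometric_pmf (1 / (1 + m))"

lemma pmf_geometric_mean:
  assumes "m > 0"
  shows "pmf (geometric_mean_pmf m) k = 1 / (1 + m) * (m / (1 + m)) ^ k"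
proof -
  have "1 - 1 / (1 + m) = m / (1 + m)"
    using assms by (simp add: field_simps)
  then show ?thesis
    using assms by (simp add: geometric_mean_pmf_def)
qed

fun offspring :: "real \<Rightarrow> real \<Rightarrow> real \<Rightarrow> nat \<times> nat \<Rightarrow> (nat \<times> nat) multiset pmf" where
  "offspring p q r (0, 0) =
     map_pmf (\<lambda>b. if b then {#(1, 0)#} else {#}) (bernoulli_pmf q)"
| "offspring p q r (0, Suc j) =
     map_pmf (\<lambda>b. if b then {#(0, j)#} else {#}) (bernoulli_pmf p)"
| "offspring p q r (Suc i, 0) =
     map_pmf (\<lambda>b. {#(Suc i, 1)#} + (if b then {#(Suc i + 1, 0)#} else {#})) (bernoulli_pmf q)"
| "offspring p q r (Suc i, Suc j) =
     map_pmf (\<lambda>k. replicate_mset k (i, Suc j) + {#(Suc i, Suc j + 1)#})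
       (geometric_mean_pmf (r powi (1 - int (Suc j))))"

definition line :: "nat \<Rightarrow> (nat \<times> nat) set" where
  "line i = {(i, j) | j. True}"

text \<open>In \<open>enat\<close> the infimum of the empty set is \<open>\<infinity>\<close>.\<close>

definition iota :: "(nat \<times> nat) set \<Rightarrow> enat" where
  "iota A = Inf {enat i | i. infinite (line i \<inter> A)}"

end

theory Submission
  imports Defs
begin

text \<open>
  Every individual on a line \<open>i \<ge> 1\<close> moves right forever and feeds line \<open>i - 1\<close>; the only way up is
  through \<open>(0, 0)\<close> and along the types \<open>(k, 0)\<close>. All types communicate, so almost surely
  \<open>(0, 0)\<close> is visited infinitely often if and only if every type is, and otherwise only finitely many
  lines are ever reached, since every chain \<open>(k, 0), (k + 1, 0), \<dots>\<close> dies out. For \<open>r \<le> 1\<close> a line also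
  almost surely reaches all lower ones. Hence, if \<open>\<iota> = \<iota>(A)\<close> is finite, extinction in \<open>A\<close> is
  almost surely the event that no line \<open>\<ge> max 1 \<iota>\<close> is ever reached, and otherwise it is the event that
  \<open>(0, 0)\<close> is visited finitely often.

  The number of visits to \<open>(0, 0)\<close> that descend from \<open>(i, j)\<close> without a renewed climb has mean of
  order \<open>(p / r ^ i) ^ j\<close> as long as \<open>p < r ^ i\<close>. In that case, starting far to the right on line
  \<open>i\<close>, the process misses \<open>(0, 0)\<close>, and so all lines above \<open>i\<close>, with positive probability, which
  separates \<open>q(L\<^sub>i)\<close> from \<open>q(L\<^bsub>i + 1\<^esub>)\<close>. If \<open>r ^ i \<le> p\<close>, each step along line \<open>i\<close> leads to
  \<open>(0, 0)\<close> with a probability bounded below, and \<open>(0, 0)\<close> is visited infinitely often.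

  For \<open>r > 1\<close> a line has, with positive probability, no offspring outside itself, so the unions
  of lines \<open>\<Union>\<^bsub>k \<in> I\<^esub> L\<^bsub>k + 1\<^esub>\<close> have distinct extinction probability vectors.
\<close>

section \<open>The branching property\<close>

text \<open>Choosing an enumerating list injects multisets into lists. Countability lets maps that
  depend on a whole generation be measured one value of that generation at a time.\<close>

instance multiset :: (countable) countable
proof
  have "M = N" if "to_nat (SOME xs. mset xs = M) = to_nat (SOME xs. mset xs = N)"
    for M N :: "'a multiset"
    using that by (metis (mono_tags, lifting) ex_mset from_nat_to_nat someI_ex)
  then show "\<exists>f :: 'a multiset \<Rightarrow> nat. inj f"
    by (intro exI[of _ "\<lambda>M. to_nat (SOME xs. mset xs = M)"] injI)
qed

text \<open>Restriction to \<open>I\<close> is the identity on the product space, so the joint law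
  of the coordinates is the product of their marginals.\<close>

lemma indep_vars_PiM_coordinates:
  assumes "\<And>i. prob_space (M i)" "I \<noteq> {}"
  shows "prob_space.indep_vars (PiM I M) M (\<lambda>i \<omega>. \<omega> i) I"
proof -
  interpret prob_space "PiM I M"
    using assms by (intro prob_space_PiM)
  have "distr (PiM I M) (PiM I M) (\<lambda>\<omega>. \<lambda>i\<in>I. \<omega> i) = distr (PiM I M) (PiM I M) (\<lambda>\<omega>. \<omega>)"
    by (intro distr_cong) (auto simp: space_PiM)
  also have "\<dots> = PiM I (\<lambda>i. distr (PiM I M) (M i) (\<lambda>\<omega>. \<omega> i))"
    using assms by (auto intro!: PiM_cong distr_PiM_component[symmetric])
  finally show ?thesis
    using assms(2) measurable_component_singleton[of _ I M] by (subst indep_vars_iff_distr_eq_PiM') simp_all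
qed

lemma prod_mset_image_sum:
  "finite A \<Longrightarrow> (\<Prod>c\<in>#(\<Sum>a\<in>A. f a). w c) = (\<Prod>a\<in>A. \<Prod>c\<in>#f a. w c :: 'b :: comm_monoid_mult)"
  by (induction A rule: finite_induct) auto

lemma space_gw_space [simp]: "space (gw_space off) = UNIV"
  by (auto simp: gw_space_def space_PiM split: prod.splits)

lemma prob_space_gw_space: "prob_space (gw_space off)"
  unfolding gw_space_def by (intro prob_space_PiM) (auto split: prod.splits intro: prob_space_measure_pmf)

lemma gw_cong:
  assumes "\<And>k y i. k < n \<Longrightarrow> \<omega> (k, y, i) = \<omega>' (k, y, i)"
  shows "gw x n \<omega> = gw x n \<omega>'"
  using assms by (induction n) auto

lemma measurable_sum_mset:
  assumes "finite A" "\<And>a. a \<in> A \<Longrightarrow> f a \<in> measurable M (count_space UNIV)"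
  shows "(\<lambda>\<omega>. \<Sum>a\<in>A. f a \<omega> :: 'b :: countable multiset) \<in> measurable M (count_space UNIV)"
  using assms
proof (induction A rule: finite_induct)
  case (insert a A)
  have "(\<lambda>\<omega>. f a \<omega> + (\<Sum>a\<in>A. f a \<omega>)) \<in> measurable M (count_space UNIV)"
    by (rule measurable_compose_countable[where f = "\<lambda>u \<omega>. u + (\<Sum>a\<in>A. f a \<omega>)"],
        rule measurable_compose[of "\<lambda>\<omega>. (\<Sum>a\<in>A. f a \<omega>)" _ "count_space UNIV"])
       (use insert in auto)
  then show ?case
    using insert by simp
qed simp

text \<open>The index set \<open>K\<close> is left free so that generation \<open>n\<close> can be
  read off from the litters of earlier generations alone; this yields its independence of the
  litters of generation \<open>n\<close>.\<close>

lemma measurable_gw_PiM: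
  fixes off :: "'a :: countable \<Rightarrow> 'a multiset pmf"
  assumes "{i. fst i < n} \<subseteq> K"
  shows "gw x n \<in> measurable (PiM K (\<lambda>(n, y, k). measure_pmf (off y))) (count_space UNIV)"
  using assms
proof (induction n)
  case (Suc n)
  have *: "(\<lambda>\<omega>. \<Sum>y\<in>set_mset z. \<Sum>k<count z y. \<omega> (n, y, k))
      \<in> measurable (PiM K (\<lambda>(n, y, k). measure_pmf (off y))) (count_space UNIV)" for z
  proof (intro measurable_sum_mset finite_set_mset finite_lessThan)
    fix y k
    have "(n, y, k) \<in> K" using Suc.prems by auto
    from measurable_component_singleton[OF this, of "\<lambda>(n, y, k). measure_pmf (off y)"]
    show "(\<lambda>\<omega>. \<omega> (n, y, k)) \<in> measurable (PiM K (\<lambda>(n, y, k). measure_pmf (off y))) (count_space UNIV)"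
      by simp
  qed
  have "{i. fst i < n} \<subseteq> K" using Suc.prems by force
  from measurable_compose_countable[OF * Suc.IH[OF this]] show ?case by simp
next
  case 0
  have "gw x 0 = (\<lambda>\<omega>. {#x#})" by (simp add: fun_eq_iff)
  then show ?case by simp
qed

lemma measurable_gw [measurable]: "gw x n \<in> measurable (gw_space off) (count_space UNIV)"
  unfolding gw_space_def by (rule measurable_gw_PiM) auto

text \<open>The events of the natural filtration at time \<open>m\<close>, encoded as invariance
  under equal histories. The encoding is stable under logical connectives, and measurability comes
  for free because there are only countably many histories.\<close>

definition adapted :: "'a :: countable \<Rightarrow> nat \<Rightarrow> ((nat \<times> 'a \<times> nat \<Rightarrow> 'a multiset) \<Rightarrow> bool) \<Rightarrow> bool" where
  "adapted x m E \<longleftrightarrow> (\<forall>\<omega> \<omega>'. (\<forall>i\<le>m. gw x i \<omega> = gw x i \<omega>') \<longrightarrow> E \<omega> = E \<omega>')"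

lemma measurable_adapted_PiM:
  fixes off :: "'a :: countable \<Rightarrow> 'a multiset pmf"
  assumes "adapted x m E" "{i. fst i < m} \<subseteq> K"
  shows "Measurable.pred (PiM K (\<lambda>(n, y, k). measure_pmf (off y))) E"
proof -
  \<comment> \<open>A history is stored as a list: lists of multisets form a countable type, so the
    quantifier over \<open>h\<close> preserves measurability.\<close>
  define Q where "Q h \<longleftrightarrow> (\<exists>\<omega>. E \<omega> \<and> (\<forall>i\<le>m. gw x i \<omega> = h ! i))" for h
  have E: "E = (\<lambda>\<omega>. \<exists>h. Q h \<and> (\<forall>i\<in>{..m}. gw x i \<omega> = h ! i))"
  proof (intro ext iffI)
    fix \<omega> assume "E \<omega>"
    then show "\<exists>h. Q h \<and> (\<forall>i\<in>{..m}. gw x i \<omega> = h ! i)"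
      by (intro exI[of _ "map (\<lambda>i. gw x i \<omega>) [0..<Suc m]"])
         (auto simp: Q_def intro!: exI[of _ \<omega>] simp del: upt_Suc)
  next
    fix \<omega> assume "\<exists>h. Q h \<and> (\<forall>i\<in>{..m}. gw x i \<omega> = h ! i)"
    then obtain h \<omega>' where "E \<omega>'" "\<forall>i\<le>m. gw x i \<omega>' = h ! i" "\<forall>i\<le>m. gw x i \<omega> = h ! i"
      by (auto simp: Q_def)
    then show "E \<omega>"
      using assms(1) unfolding adapted_def by metis
  qed
  have [measurable]: "gw x i \<in> measurable (PiM K (\<lambda>(n, y, k). measure_pmf (off y))) (count_space UNIV)"
    if "i \<in> {..m}" for i
    by (rule measurable_gw_PiM) (use assms(2) that in force)
  show ?thesis
    unfolding E by measurable
qed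

lemma measurable_adapted:
  "adapted x m E \<Longrightarrow> Measurable.pred (gw_space off) E"
  unfolding gw_space_def by (rule measurable_adapted_PiM) auto

text \<open>Once generation \<open>m\<close> is fixed to be \<open>z\<close>, the litters that form
  the next generation are a fixed finite family, indexed by \<open>J\<close>. They are independent
  of each other and of the past, so the expectation factorises.\<close>

lemma gw_markov_fixed:
  fixes w :: "'a::countable \<Rightarrow> ennreal" and off :: "'a \<Rightarrow> 'a multiset pmf"
  assumes E: "adapted x m E"
  defines "G \<equiv> \<lambda>y. \<integral>\<^sup>+M. (\<Prod>c\<in>#M. w c) \<partial>measure_pmf (off y)"
  shows "(\<integral>\<^sup>+\<omega>. indicator {\<omega>. E \<omega> \<and> gw x m \<omega> = z} \<omega> * (\<Prod>c\<in>#gw x (Suc m) \<omega>. w c) \<partial>gw_space off) =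
    (\<integral>\<^sup>+\<omega>. indicator {\<omega>. E \<omega> \<and> gw x m \<omega> = z} \<omega> * (\<Prod>y\<in>#gw x m \<omega>. G y) \<partial>gw_space off)"
proof -
  interpret prob_space "gw_space off" by (rule prob_space_gw_space)
  let ?N = "\<lambda>(n::nat, y, k::nat). measure_pmf (off y)"
  let ?W = "\<lambda>M. \<Prod>c\<in>#M. w c"
  define J where "J = Sigma (set_mset z) (\<lambda>y. {..<count z y})"
  \<comment> \<open>Block \<open>None\<close> collects all litters of generations before
    \<open>m\<close>, block \<open>Some j\<close> the single litter \<open>(m, j)\<close>. The
    blocks are disjoint, so functions of different blocks are independent.\<close>
  define K where "K = case_option {i :: nat \<times> 'a \<times> nat. fst i < m} (\<lambda>j. {(m, j)})"
  define L where "L = insert None (Some ` J)"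
  define E' where "E' \<omega> \<longleftrightarrow> E \<omega> \<and> gw x m \<omega> = z" for \<omega>
  define Y where "Y = case_option (indicator {\<omega>. E' \<omega>} :: (nat \<times> 'a \<times> nat \<Rightarrow> 'a multiset) \<Rightarrow> ennreal)
    (\<lambda>j r. ?W (r (m, j)))"
  have fin: "finite J" by (auto simp: J_def)
  have E': "adapted x m E'"
    using E unfolding adapted_def E'_def by (metis order_refl)
  have G: "(\<integral>\<^sup>+\<omega>. ?W (\<omega> (m, y, k)) \<partial>gw_space off) = G y" for y k
  proof -
    have "measure_pmf (off y) = distr (gw_space off) (measure_pmf (off y)) (\<lambda>\<omega>. \<omega> (m, y, k))"
      unfolding gw_space_def
      by (subst distr_PiM_component[of UNIV ?N "(m, y, k)", simplified])
         (auto split: prod.splits intro: prob_space_measure_pmf)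
    then have "G y = (\<integral>\<^sup>+M. ?W M \<partial>distr (gw_space off) (measure_pmf (off y)) (\<lambda>\<omega>. \<omega> (m, y, k)))"
      by (simp add: G_def)
    also have "\<dots> = (\<integral>\<^sup>+\<omega>. ?W (\<omega> (m, y, k)) \<partial>gw_space off)"
      using measurable_component_singleton[of "(m, y, k)" UNIV ?N]
      by (intro nn_integral_distr) (auto simp: gw_space_def)
    finally show ?thesis by simp
  qed
  have GJ: "(\<integral>\<^sup>+\<omega>. ?W (\<omega> (m, j)) \<partial>gw_space off) = G (fst j)" for j
    using G[of "fst j" "snd j"] by simp
  have "indep_vars ?N (\<lambda>i \<omega>. \<omega> i) UNIV"
    unfolding gw_space_def
    by (rule indep_vars_PiM_coordinates) (auto split: prod.splits intro: prob_space_measure_pmf)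
  then have "indep_vars (\<lambda>j. PiM (K j) ?N) (\<lambda>j \<omega>. restrict (\<lambda>i. \<omega> i) (K j)) L"
    by (rule indep_vars_restrict) (auto simp: K_def L_def disjoint_family_on_def split: option.splits)
  then have "indep_vars (\<lambda>_. borel) (\<lambda>j \<omega>. Y j (restrict (\<lambda>i. \<omega> i) (K j))) L"
  proof (rule indep_vars_compose2)
    fix j assume "j \<in> L"
    show "Y j \<in> borel_measurable (PiM (K j) ?N)"
    proof (cases j)
      case None
      have [measurable]: "Measurable.pred (PiM (K None) ?N) E'"
        by (rule measurable_adapted_PiM[OF E']) (auto simp: K_def)
      show ?thesis by (simp add: None Y_def)
    next
      case (Some i)
      have "(m, i) \<in> K j" by (auto simp: K_def Some)
      from measurable_component_singleton[OF this, of ?N]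
      have "(\<lambda>\<omega>. \<omega> (m, i)) \<in> measurable (PiM (K j) ?N) (count_space UNIV)"
        by (cases i) simp
      then show ?thesis by (auto simp: Some Y_def)
    qed
  qed
  then have "(\<integral>\<^sup>+\<omega>. (\<Prod>j\<in>L. Y j (restrict (\<lambda>i. \<omega> i) (K j))) \<partial>gw_space off) =
     (\<Prod>j\<in>L. \<integral>\<^sup>+\<omega>. Y j (restrict (\<lambda>i. \<omega> i) (K j)) \<partial>gw_space off)"
    by (intro indep_vars_nn_integral) (auto simp: L_def fin)
  moreover have "Y None (restrict \<omega> (K None)) = indicator {\<omega>. E' \<omega>} \<omega>" for \<omega>
  proof -
    have "gw x i (restrict \<omega> (K None)) = gw x i \<omega>" if "i \<le> m" for i
      by (rule gw_cong) (use that in \<open>auto simp: K_def\<close>)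
    then have "E' (restrict \<omega> (K None)) = E' \<omega>"
      using E' unfolding adapted_def by blast
    then show ?thesis by (simp add: Y_def indicator_def)
  qed
  moreover have "Y (Some j) (restrict \<omega> (K (Some j))) = ?W (\<omega> (m, j))" for \<omega> j
    by (simp add: Y_def K_def)
  ultimately have *: "(\<integral>\<^sup>+\<omega>. indicator {\<omega>. E' \<omega>} \<omega> * (\<Prod>j\<in>J. ?W (\<omega> (m, j))) \<partial>gw_space off) =
     (\<integral>\<^sup>+\<omega>. indicator {\<omega>. E' \<omega>} \<omega> \<partial>gw_space off) * (\<Prod>j\<in>J. G (fst j))"
    by (simp add: L_def fin prod.reindex GJ del: split_paired_All)
  have J1: "(\<Prod>j\<in>J. g j) = (\<Prod>y\<in>set_mset z. \<Prod>k<count z y. g (y, k) :: ennreal)" for g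
    using prod.Sigma[of "set_mset z" "\<lambda>y. {..<count z y}" "\<lambda>y k. g (y, k)"] by (simp add: J_def)
  have J2: "(\<Prod>j\<in>J. G (fst j)) = (\<Prod>y\<in>#z. G y)"
    by (simp add: J1 image_prod_mset_multiplicity)
  have "(\<integral>\<^sup>+\<omega>. indicator {\<omega>. E' \<omega>} \<omega> * (\<Prod>c\<in>#gw x (Suc m) \<omega>. w c) \<partial>gw_space off) =
      (\<integral>\<^sup>+\<omega>. indicator {\<omega>. E' \<omega>} \<omega> * (\<Prod>j\<in>J. ?W (\<omega> (m, j))) \<partial>gw_space off)"
    by (intro nn_integral_cong) (auto simp: indicator_def E'_def J1 prod_mset_image_sum)
  also have "\<dots> = (\<integral>\<^sup>+\<omega>. indicator {\<omega>. E' \<omega>} \<omega> * (\<Prod>y\<in>#z. G y) \<partial>gw_space off)"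
    unfolding * J2 using measurable_adapted[OF E', of off] by (simp add: nn_integral_multc)
  also have "\<dots> = (\<integral>\<^sup>+\<omega>. indicator {\<omega>. E' \<omega>} \<omega> * (\<Prod>y\<in>#gw x m \<omega>. G y) \<partial>gw_space off)"
    by (intro nn_integral_cong) (auto simp: indicator_def E'_def)
  finally show ?thesis by (simp add: E'_def)
qed

text \<open>The one-step branching property for generating functionals: averaging over the next
  generation turns the weight \<open>w\<close> into \<open>G\<close>. The proof sums
  \<open>gw_markov_fixed\<close> over the countably many values of generation
  \<open>m\<close>.\<close>

lemma gw_markov:
  fixes w :: "'a::countable \<Rightarrow> ennreal" and off :: "'a \<Rightarrow> 'a multiset pmf"
  assumes E: "adapted x m E"
  defines "G \<equiv> \<lambda>y. \<integral>\<^sup>+M. (\<Prod>c\<in>#M. w c) \<partial>measure_pmf (off y)"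
  shows "(\<integral>\<^sup>+\<omega>. indicator {\<omega>. E \<omega>} \<omega> * (\<Prod>c\<in>#gw x (Suc m) \<omega>. w c) \<partial>gw_space off) =
    (\<integral>\<^sup>+\<omega>. indicator {\<omega>. E \<omega>} \<omega> * (\<Prod>y\<in>#gw x m \<omega>. G y) \<partial>gw_space off)"
proof -
  have [measurable]: "Measurable.pred (gw_space off) E"
    using E by (rule measurable_adapted)
  have m [measurable]: "(\<lambda>\<omega>. \<Prod>c\<in>#gw x n \<omega>. h c) \<in> borel_measurable (gw_space off)" 
    for n and h :: "'a \<Rightarrow> ennreal"
    by (rule measurable_compose[OF measurable_gw]) auto
  have split: "(\<integral>\<^sup>+\<omega>. indicator {\<omega>. E \<omega>} \<omega> * f \<omega> \<partial>gw_space off) =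
      (\<integral>\<^sup>+z. \<integral>\<^sup>+\<omega>. indicator {\<omega>. E \<omega> \<and> gw x m \<omega> = z} \<omega> * f \<omega> \<partial>gw_space off \<partial>count_space UNIV)"
    if [measurable]: "f \<in> borel_measurable (gw_space off)" for f
  proof -
    have "(\<integral>\<^sup>+\<omega>. indicator {\<omega>. E \<omega>} \<omega> * f \<omega> \<partial>gw_space off) =
       (\<integral>\<^sup>+\<omega>. \<integral>\<^sup>+z. indicator {\<omega>. E \<omega> \<and> gw x m \<omega> = z} \<omega> * f \<omega> \<partial>count_space UNIV \<partial>gw_space off)"
    proof (intro nn_integral_cong)
      fix \<omega>
      have "(\<integral>\<^sup>+z. indicator {\<omega>. E \<omega> \<and> gw x m \<omega> = z} \<omega> * f \<omega> \<partial>count_space UNIV) =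
         (\<integral>\<^sup>+z. indicator {\<omega>. E \<omega>} \<omega> * f \<omega> * indicator {gw x m \<omega>} z \<partial>count_space UNIV)"
        by (intro nn_integral_cong) (auto simp: indicator_def)
      then show "indicator {\<omega>. E \<omega>} \<omega> * f \<omega> =
         (\<integral>\<^sup>+z. indicator {\<omega>. E \<omega> \<and> gw x m \<omega> = z} \<omega> * f \<omega> \<partial>count_space UNIV)"
        by simp
    qed
    also have "\<dots> = (\<integral>\<^sup>+z. \<integral>\<^sup>+\<omega>. indicator {\<omega>. E \<omega> \<and> gw x m \<omega> = z} \<omega> * f \<omega> \<partial>gw_space off \<partial>count_space UNIV)"
      by (rule nn_integral_count_space_nn_integral) auto
    finally show ?thesis .
  qed
  show ?thesis
    unfolding split[OF m] G_def by (rule nn_integral_cong, rule gw_markov_fixed[OF E])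
qed

lemma adapted_mono: "adapted x m E \<Longrightarrow> m \<le> n \<Longrightarrow> adapted x n E"
  unfolding adapted_def by (meson order_trans)

lemma adapted_gw: "i \<le> m \<Longrightarrow> adapted x m (\<lambda>\<omega>. P (gw x i \<omega>))"
  unfolding adapted_def by metis

lemma adapted_const: "adapted x m (\<lambda>_. P)"
  by (simp add: adapted_def)

lemma adapted_conj: "adapted x m P \<Longrightarrow> adapted x m Q \<Longrightarrow> adapted x m (\<lambda>\<omega>. P \<omega> \<and> Q \<omega>)"
  unfolding adapted_def by metis

lemma adapted_not: "adapted x m P \<Longrightarrow> adapted x m (\<lambda>\<omega>. \<not> P \<omega>)"
  unfolding adapted_def by metis

lemma adapted_imp: "(P \<Longrightarrow> adapted x m Q) \<Longrightarrow> adapted x m (\<lambda>\<omega>. P \<longrightarrow> Q \<omega>)"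
  unfolding adapted_def by metis

lemma adapted_all: "(\<And>i. adapted x m (P i)) \<Longrightarrow> adapted x m (\<lambda>\<omega>. \<forall>i. P i \<omega>)"
  unfolding adapted_def by metis

section \<open>Avoiding a type for one generation\<close>

lemma prod_mset_of_bool:
  "(\<Prod>c\<in>#M. of_bool (P c)) = (of_bool (\<forall>c\<in>#M. P c) :: 'b :: comm_semiring_1)"
  by (induction M) auto

lemma sets_gw_space_Collect:
  "Measurable.pred (gw_space off) P \<Longrightarrow> {\<omega>. P \<omega>} \<in> sets (gw_space off)"
  by (simp add: pred_def)

lemma sets_adapted: "adapted x m E \<Longrightarrow> {\<omega>. E \<omega>} \<in> sets (gw_space off)"
  by (intro sets_gw_space_Collect measurable_adapted)

lemma prod_mset_le_1:
  "(\<And>y. y \<in># M \<Longrightarrow> f y \<le> 1) \<Longrightarrow> (\<Prod>y\<in>#M. f y) \<le> (1 :: ennreal)"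
proof (induction M)
  case (add y M)
  then have "f y * (\<Prod>y\<in>#M. f y) \<le> 1 * 1" by (intro mult_mono) auto
  then show ?case by simp
qed simp

lemma prod_mset_le_factor:
  assumes "y \<in># M" "\<And>y. y \<in># M \<Longrightarrow> f y \<le> 1"
  shows "(\<Prod>y\<in>#M. f y) \<le> (f y :: ennreal)"
proof -
  obtain M' where M: "M = add_mset y M'"
    using assms(1) by (metis multi_member_split)
  have "(\<Prod>y\<in>#M'. f y) \<le> 1"
    using assms(2) by (intro prod_mset_le_1) (auto simp: M)
  then show ?thesis
    using mult_left_mono[of _ 1 "f y"] by (auto simp: M)
qed

text \<open>With the weight \<open>of_bool (c \<noteq> z)\<close> the product over a generation is
  the indicator that \<open>z\<close> is absent from it.\<close>

lemma emeasure_avoid_type_Suc: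
  assumes "adapted x m E"
  shows "emeasure (gw_space off) {\<omega>. E \<omega> \<and> z \<notin># gw x (Suc m) \<omega>} =
    (\<integral>\<^sup>+\<omega>. indicator {\<omega>. E \<omega>} \<omega> *
       (\<Prod>y\<in>#gw x m \<omega>. emeasure (measure_pmf (off y)) {M. z \<notin># M}) \<partial>gw_space off)"
proof -
  have [measurable]: "Measurable.pred (gw_space off) E"
    using assms by (rule measurable_adapted)
  have eq: "(\<integral>\<^sup>+M. of_bool (\<forall>c\<in>#M. c \<noteq> z) \<partial>measure_pmf (off y)) =
      emeasure (measure_pmf (off y)) {M. z \<notin># M}" for y
  proof -
    have "(\<lambda>M. of_bool (\<forall>c\<in>#M. c \<noteq> z)) = (indicator {M. z \<notin># M} :: 'a multiset \<Rightarrow> ennreal)"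
      by (auto simp: fun_eq_iff indicator_def)
    then show ?thesis by simp
  qed
  have "(\<integral>\<^sup>+\<omega>. indicator {\<omega>. E \<omega>} \<omega> *
       (\<Prod>y\<in>#gw x m \<omega>. emeasure (measure_pmf (off y)) {M. z \<notin># M}) \<partial>gw_space off) =
     (\<integral>\<^sup>+\<omega>. indicator {\<omega>. E \<omega>} \<omega> *
       (\<Prod>c\<in>#gw x (Suc m) \<omega>. of_bool (c \<noteq> z)) \<partial>gw_space off)"
    by (subst gw_markov[OF assms]) (simp add: prod_mset_of_bool eq)
  also have "\<dots> = (\<integral>\<^sup>+\<omega>. indicator {\<omega>. E \<omega> \<and> z \<notin># gw x (Suc m) \<omega>} \<omega> \<partial>gw_space off)"
    by (intro nn_integral_cong) (auto simp: prod_mset_of_bool indicator_def simp del: gw.simps)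
  also have "\<dots> = emeasure (gw_space off) {\<omega>. E \<omega> \<and> z \<notin># gw x (Suc m) \<omega>}"
    by (intro nn_integral_indicator sets_gw_space_Collect) measurable
  finally show ?thesis ..
qed

text \<open>All factors are at most 1, so it is enough to keep the factor of one
  type-\<open>y\<close> individual that \<open>E\<close> guarantees.\<close>

lemma measure_avoid_type_Suc_le:
  assumes "adapted x m E" "\<And>\<omega>. E \<omega> \<Longrightarrow> y \<in># gw x m \<omega>"
  shows "measure (gw_space off) {\<omega>. E \<omega> \<and> z \<notin># gw x (Suc m) \<omega>} \<le>
    measure_pmf.prob (off y) {M. z \<notin># M} * measure (gw_space off) {\<omega>. E \<omega>}"
proof -
  interpret prob_space "gw_space off" by (rule prob_space_gw_space)
  have [measurable]: "Measurable.pred (gw_space off) E"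
    using assms by (auto intro: measurable_adapted)
  have "emeasure (gw_space off) {\<omega>. E \<omega> \<and> z \<notin># gw x (Suc m) \<omega>} \<le>
    (\<integral>\<^sup>+\<omega>. emeasure (measure_pmf (off y)) {M. z \<notin># M} * indicator {\<omega>. E \<omega>} \<omega> \<partial>gw_space off)"
    unfolding emeasure_avoid_type_Suc[OF assms(1)]
    using assms(2)
    by (intro nn_integral_mono)
       (auto simp: indicator_def intro!: prod_mset_le_factor measure_pmf.emeasure_le_1)
  also have "\<dots> = emeasure (measure_pmf (off y)) {M. z \<notin># M} * emeasure (gw_space off) {\<omega>. E \<omega>}"
    using sets_adapted[OF assms(1)] by (simp add: nn_integral_cmult)
  finally show ?thesis
    by (simp add: emeasure_eq_measure measure_pmf.emeasure_eq_measure flip: ennreal_mult)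
qed

text \<open>Only type-\<open>y\<close> parents can contribute a factor below 1, and on
  \<open>E\<close> there are at most \<open>N\<close> of them.\<close>

lemma measure_avoid_type_Suc_ge:
  assumes "adapted x m E"
    and "\<And>\<omega>. E \<omega> \<Longrightarrow> count (gw x m \<omega>) y \<le> N"
    and "\<And>y'. y' \<noteq> y \<Longrightarrow> measure_pmf.prob (off y') {M. z \<notin># M} = 1"
  shows "measure_pmf.prob (off y) {M. z \<notin># M} ^ N * measure (gw_space off) {\<omega>. E \<omega>} \<le>
    measure (gw_space off) {\<omega>. E \<omega> \<and> z \<notin># gw x (Suc m) \<omega>}"
proof -
  interpret prob_space "gw_space off" by (rule prob_space_gw_space)
  have [measurable]: "Measurable.pred (gw_space off) E"
    using assms by (auto intro: measurable_adapted)
  let ?e = "emeasure (measure_pmf (off y)) {M. z \<notin># M}"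
  have prod: "(\<Prod>y\<in>#Z. emeasure (measure_pmf (off y)) {M. z \<notin># M}) = ?e ^ count Z y" for Z
    using assms(3) by (induction Z) (auto simp: measure_pmf.emeasure_eq_measure)
  have "?e ^ N * emeasure (gw_space off) {\<omega>. E \<omega>} = 
    (\<integral>\<^sup>+\<omega>. ?e ^ N * indicator {\<omega>. E \<omega>} \<omega> \<partial>gw_space off)"
    using sets_adapted[OF assms(1)] by (simp add: nn_integral_cmult)
  also have "\<dots> \<le> emeasure (gw_space off) {\<omega>. E \<omega> \<and> z \<notin># gw x (Suc m) \<omega>}"
    unfolding emeasure_avoid_type_Suc[OF assms(1)] prod
    using assms(2)
    by (intro nn_integral_mono)
       (auto simp: indicator_def intro!: power_decreasing measure_pmf.emeasure_le_1)
  finally show ?thesis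
    by (simp add: emeasure_eq_measure measure_pmf.emeasure_eq_measure ennreal_power flip: ennreal_mult)
qed

section \<open>Recurrence of types\<close>

text \<open>
  A conditional second Borel--Cantelli lemma. If \<open>a\<close> is the probability that trials occur infinitely
  often but never succeed from time \<open>N\<close> on, conditioning at the first trial after time \<open>m\<close> and
  letting \<open>m\<close> tend to infinity gives \<open>a \<le> (1 - c) a\<close>.
\<close>

lemma AE_trials_succeed_infinitely_often:
  fixes T R :: "nat \<Rightarrow> (nat \<times> 'a::countable \<times> nat \<Rightarrow> 'a multiset) \<Rightarrow> bool"
  assumes T: "\<And>n. adapted x n (T n)" and R: "\<And>n. adapted x (Suc n) (R n)" and c: "0 < (c::real)"
    and step: "\<And>n E. adapted x n E \<Longrightarrow> (\<And>\<omega>. E \<omega> \<Longrightarrow> T n \<omega>) \<Longrightarrow>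
      measure (gw_space off) {\<omega>. E \<omega> \<and> \<not> R n \<omega>} \<le> (1 - c) * measure (gw_space off) {\<omega>. E \<omega>}"
  shows "AE \<omega> in gw_space off. (\<exists>\<^sub>\<infinity>n. T n \<omega>) \<longrightarrow> (\<exists>\<^sub>\<infinity>n. T n \<omega> \<and> R n \<omega>)"
proof -
  interpret prob_space "gw_space off" by (rule prob_space_gw_space)
  note [measurable] = measurable_adapted[OF T, of _ off] measurable_adapted[OF R, of _ off]
  have "AE \<omega> in gw_space off. \<not> ((\<exists>\<^sub>\<infinity>n. T n \<omega>) \<and> (\<forall>n\<ge>N. \<not> (T n \<omega> \<and> R n \<omega>)))" for N
  proof -
    \<comment> \<open>\<open>B\<close> is the bad event. \<open>D m\<close> looks only at trials at
      times \<open>n < m\<close>, because the outcome \<open>R n\<close> is revealed one generation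
      after the trial; hence \<open>D m\<close> is known at time \<open>m\<close>. The events
      \<open>W m\<close> decrease to \<open>B\<close>.\<close>
    define D where "D m \<omega> \<longleftrightarrow> (\<forall>n. N \<le> n \<longrightarrow> n < m \<longrightarrow> \<not> (T n \<omega> \<and> R n \<omega>))" for m \<omega>
    define B where "B = {\<omega>. (\<exists>\<^sub>\<infinity>n. T n \<omega>) \<and> (\<forall>n\<ge>N. \<not> (T n \<omega> \<and> R n \<omega>))}"
    define W where "W m = {\<omega>. D m \<omega> \<and> (\<exists>n\<ge>m. T n \<omega>)}" for m
    have D: "adapted x m (D m)" for m
      unfolding D_def
    proof (intro adapted_all)
      fix n
      show "adapted x m (\<lambda>\<omega>. N \<le> n \<longrightarrow> n < m \<longrightarrow> \<not> (T n \<omega> \<and> R n \<omega>))"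
        by (intro adapted_imp adapted_not adapted_conj adapted_mono[OF T] adapted_mono[OF R]) auto
    qed
    have [measurable]: "Measurable.pred (gw_space off) (D m)" for m
      using D by (rule measurable_adapted)
    have Wm [measurable]: "W m \<in> sets (gw_space off)" for m
      unfolding W_def by (rule sets_gw_space_Collect) measurable
    have Bm [measurable]: "B \<in> sets (gw_space off)"
      unfolding B_def INFM_nat by (rule sets_gw_space_Collect) measurable
    have le: "prob B \<le> (1 - c) * prob (W m)" if "N \<le> m" for m
    proof -
      \<comment> \<open>\<open>F n\<close> splits \<open>W m\<close> according to the time
        \<open>n\<close> of the first trial from \<open>m\<close> on. It is known at time
        \<open>n\<close>, so \<open>step\<close> applies to it, and on \<open>B\<close> that first
        trial fails.\<close>
      define F where "F n = {\<omega>. D m \<omega> \<and> (m \<le> n \<and> T n \<omega> \<and> (\<forall>k. m \<le> k \<and> k < n \<longrightarrow> \<not> T k \<omega>))}" for n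
      have F: "adapted x n (\<lambda>\<omega>. \<omega> \<in> F n)" for n
      proof (cases "m \<le> n")
        case True
        have "adapted x n (\<lambda>\<omega>. m \<le> k \<and> k < n \<longrightarrow> \<not> T k \<omega>)" for k
          by (intro adapted_imp adapted_not adapted_mono[OF T]) auto
        then show ?thesis
          unfolding F_def mem_Collect_eq
          by (intro adapted_conj adapted_all adapted_mono[OF D True] adapted_const T)
      qed (auto simp: F_def intro: adapted_const)
      have [measurable]: "F n \<in> sets (gw_space off)" for n
        using sets_adapted[OF F[of n], of off] by simp
      have "disjoint_family F"
        unfolding disjoint_family_on_def F_def by (auto, metis linorder_neqE_nat)
      moreover have "W m = (\<Union>n. F n)"
      proof -
        have "\<exists>n. m \<le> n \<and> T n \<omega> \<and> (\<forall>k. m \<le> k \<and> k < n \<longrightarrow> \<not> T k \<omega>)" if "n \<ge> m" "T n \<omega>" for n \<omega>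
          using that exists_least_iff[of "\<lambda>n. m \<le> n \<and> T n \<omega>"] by blast
        then show ?thesis by (auto simp: W_def F_def)
      qed
      ultimately have sums: "(\<lambda>n. prob (F n)) sums prob (W m)"
        by (auto intro!: finite_measure_UNION)
      define F' where "F' n = {\<omega>. \<omega> \<in> F n \<and> \<not> R n \<omega>}" for n
      have F'm: "F' n \<in> sets (gw_space off)" for n
        unfolding F'_def by (rule sets_gw_space_Collect) measurable
      have F'_le: "prob (F' n) \<le> (1 - c) * prob (F n)" for n
        using step[OF F[of n]] by (auto simp: F_def F'_def)
      have summ: "summable (\<lambda>n. prob (F' n))"
        by (rule summable_comparison_test'[where g = "\<lambda>n. (1 - c) * prob (F n)" and N = 0])
           (use F'_le sums in \<open>auto intro: summable_mult sums_summable\<close>)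
      have "B \<subseteq> (\<Union>n. F' n)"
      proof
        fix \<omega> assume B: "\<omega> \<in> B"
        then have "\<omega> \<in> W m" by (auto simp: B_def W_def D_def INFM_nat_le)
        then obtain n where "\<omega> \<in> F n" using \<open>W m = (\<Union>n. F n)\<close> by auto
        moreover from this have "\<not> R n \<omega>" using B \<open>N \<le> m\<close> by (auto simp: F_def B_def)
        ultimately show "\<omega> \<in> (\<Union>n. F' n)" by (auto simp: F'_def)
      qed
      then have "prob B \<le> prob (\<Union>n. F' n)"
        using F'm by (intro finite_measure_mono) auto
      also have "\<dots> \<le> (\<Sum>n. prob (F' n))"
        using F'm summ by (intro finite_measure_subadditive_countably) auto
      also have "\<dots> \<le> (\<Sum>n. (1 - c) * prob (F n))"
        using F'_le summ sums by (intro suminf_le) (auto intro: summable_mult sums_summable)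
      also have "\<dots> = (1 - c) * prob (W m)"
        using sums by (metis sums_mult sums_unique)
      finally show ?thesis .
    qed
    have "(\<lambda>m. prob (W (N + m))) \<longlonglongrightarrow> prob (\<Inter>m. W (N + m))"
    proof (rule finite_Lim_measure_decseq)
      show "decseq (\<lambda>m. W (N + m))"
        unfolding decseq_Suc_iff by (auto simp: W_def D_def less_Suc_eq) (meson Suc_leD)+
    qed auto
    moreover have "(\<Inter>m. W (N + m)) = B"
    proof (intro set_eqI iffI)
      fix \<omega> assume *: "\<omega> \<in> (\<Inter>m. W (N + m))"
      have "\<not> (T n \<omega> \<and> R n \<omega>)" if "N \<le> n" for n
        using INT_D[OF *, of "Suc n"] that by (auto simp: W_def D_def)
      moreover have "\<exists>n\<ge>m. T n \<omega>" for m
        using INT_D[OF *, of m] by (auto simp: W_def) (meson add_leE)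
      ultimately show "\<omega> \<in> B"
        by (auto simp: B_def INFM_nat_le)
    qed (auto simp: B_def W_def D_def INFM_nat_le)
    ultimately have "(\<lambda>m. (1 - c) * prob (W (N + m))) \<longlonglongrightarrow> (1 - c) * prob B"
      by (intro tendsto_mult_left) simp
    then have "prob B \<le> (1 - c) * prob B"
      by (rule LIMSEQ_le_const) (use le in auto)
    then have "c * prob B \<le> 0"
      by (simp add: algebra_simps)
    then have "prob B = 0"
      using c by (simp add: mult_le_0_iff measure_le_0_iff)
    then have "B \<in> null_sets (gw_space off)"
      using Bm by (intro null_setsI) (simp_all add: emeasure_eq_measure)
    then show ?thesis
      by (rule AE_I') (auto simp: B_def)
  qed
  then have "AE \<omega> in gw_space off. \<forall>N. \<not> ((\<exists>\<^sub>\<infinity>n. T n \<omega>) \<and> (\<forall>n\<ge>N. \<not> (T n \<omega> \<and> R n \<omega>)))"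
    by (simp only: AE_all_countable) simp
  then show ?thesis
    by eventually_elim (auto simp: INFM_nat_le)
qed

section \<open>Avoiding a type\<close>

text \<open>First-generation recursion for the probability that \<open>b\<close> is absent from
  generations \<open>0\<close> to \<open>n\<close> of the process started from \<open>y\<close>;
  \<open>emeasure_avoid_start\<close> justifies this reading.\<close>

primrec avoid :: "('a::countable \<Rightarrow> 'a multiset pmf) \<Rightarrow> 'a \<Rightarrow> nat \<Rightarrow> 'a \<Rightarrow> ennreal" where
  "avoid off b 0 y = of_bool (y \<noteq> b)"
| "avoid off b (Suc n) y =
     of_bool (y \<noteq> b) * (\<integral>\<^sup>+M. (\<Prod>c\<in>#M. avoid off b n c) \<partial>measure_pmf (off y))"

text \<open>Absence from generation \<open>k\<close> is absorbed into the event, the window of the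
  remaining \<open>n\<close> generations starts at \<open>Suc k\<close>, and
  \<open>gw_markov\<close> pulls the product back to generation \<open>k\<close>. This is why
  \<open>k\<close> and \<open>E\<close> vary in the induction.\<close>

lemma emeasure_avoid:
  assumes "adapted x k E"
  shows "emeasure (gw_space off) {\<omega>. E \<omega> \<and> (\<forall>i\<le>n. b \<notin># gw x (k + i) \<omega>)} =
    (\<integral>\<^sup>+\<omega>. indicator {\<omega>. E \<omega>} \<omega> * (\<Prod>y\<in>#gw x k \<omega>. avoid off b n y) \<partial>gw_space off)"
  using assms
proof (induction n arbitrary: k E)
  case 0
  have [measurable]: "Measurable.pred (gw_space off) E"
    using 0 by (rule measurable_adapted)
  have "(\<integral>\<^sup>+\<omega>. indicator {\<omega>. E \<omega>} \<omega> * (\<Prod>y\<in>#gw x k \<omega>. avoid off b 0 y) \<partial>gw_space off) =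
     (\<integral>\<^sup>+\<omega>. indicator {\<omega>. E \<omega> \<and> b \<notin># gw x k \<omega>} \<omega> \<partial>gw_space off)"
    by (intro nn_integral_cong) (auto simp: prod_mset_of_bool indicator_def simp del: gw.simps)
  also have "\<dots> = emeasure (gw_space off) {\<omega>. E \<omega> \<and> b \<notin># gw x k \<omega>}"
    by (intro nn_integral_indicator sets_gw_space_Collect) measurable
  finally show ?case by simp
next
  case (Suc n)
  define E' where "E' \<omega> \<longleftrightarrow> E \<omega> \<and> b \<notin># gw x k \<omega>" for \<omega>
  have E': "adapted x k E'"
    unfolding E'_def by (intro adapted_conj Suc.prems adapted_gw) auto
  let ?G = "\<lambda>y. \<integral>\<^sup>+M. (\<Prod>c\<in>#M. avoid off b n c) \<partial>measure_pmf (off y)"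
  have prod: "(\<Prod>y\<in>#Z. avoid off b (Suc n) y) = of_bool (b \<notin># Z) * (\<Prod>y\<in>#Z. ?G y)" for Z
    by (induction Z) auto
  have "{\<omega>. E \<omega> \<and> (\<forall>i\<le>Suc n. b \<notin># gw x (k + i) \<omega>)} =
      {\<omega>. E' \<omega> \<and> (\<forall>i\<le>n. b \<notin># gw x (Suc k + i) \<omega>)}"
    by (auto simp: E'_def simp del: gw.simps) (metis Suc_le_mono add_0_right add_Suc_right not0_implies_Suc)
  also have "emeasure (gw_space off) \<dots> =
     (\<integral>\<^sup>+\<omega>. indicator {\<omega>. E' \<omega>} \<omega> * (\<Prod>y\<in>#gw x (Suc k) \<omega>. avoid off b n y) \<partial>gw_space off)"
    by (intro Suc.IH adapted_mono[OF E']) simp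
  also have "\<dots> = (\<integral>\<^sup>+\<omega>. indicator {\<omega>. E' \<omega>} \<omega> * (\<Prod>y\<in>#gw x k \<omega>. ?G y) \<partial>gw_space off)"
    by (rule gw_markov[OF E'])
  also have "\<dots> = (\<integral>\<^sup>+\<omega>. indicator {\<omega>. E \<omega>} \<omega> * (\<Prod>y\<in>#gw x k \<omega>. avoid off b (Suc n) y) \<partial>gw_space off)"
    unfolding prod by (intro nn_integral_cong) (auto simp: E'_def indicator_def)
  finally show ?case .
qed

lemma avoid_le_1: "avoid off b n y \<le> 1"
proof (induction n arbitrary: y)
  case (Suc n)
  have "(\<integral>\<^sup>+M. (\<Prod>c\<in>#M. avoid off b n c) \<partial>measure_pmf (off y)) \<le> (\<integral>\<^sup>+M. 1 \<partial>measure_pmf (off y))"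
    by (intro nn_integral_mono prod_mset_le_1 Suc)
  then show ?case
    by (auto simp: indicator_def)
qed (auto simp: indicator_def)

lemma emeasure_avoid_start:
  "emeasure (gw_space off) {\<omega>. \<forall>i\<le>n. b \<notin># gw x i \<omega>} = avoid off b n x"
proof -
  interpret prob_space "gw_space off" by (rule prob_space_gw_space)
  show ?thesis
    using emeasure_avoid[OF adapted_const[of x 0 True], of off n b] emeasure_space_1 by simp
qed

text \<open>If \<open>y\<close> occurs in generation \<open>k\<close>, its own factor bounds the
  chance that \<open>b\<close> is absent from generations \<open>k\<close> to \<open>k + n\<close>.
  Let \<open>n\<close> tend to infinity; only countably many \<open>k\<close> matter.\<close>

lemma AE_hits_if_avoid_tendsto_0:
  assumes "(\<lambda>n. avoid off b n y) \<longlonglongrightarrow> 0"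
  shows "AE \<omega> in gw_space off. \<forall>k. y \<in># gw x k \<omega> \<longrightarrow> (\<exists>i\<ge>k. b \<in># gw x i \<omega>)"
  unfolding AE_all_countable
proof
  fix k
  interpret prob_space "gw_space off" by (rule prob_space_gw_space)
  let ?A = "{\<omega>. y \<in># gw x k \<omega> \<and> (\<forall>i. b \<notin># gw x (k + i) \<omega>)}"
  have "emeasure (gw_space off) ?A \<le> avoid off b n y" for n
  proof -
    have "emeasure (gw_space off) ?A \<le>
        emeasure (gw_space off) {\<omega>. y \<in># gw x k \<omega> \<and> (\<forall>i\<le>n. b \<notin># gw x (k + i) \<omega>)}"
      by (intro emeasure_mono sets_gw_space_Collect) (auto, measurable)
    also have "\<dots> = (\<integral>\<^sup>+\<omega>. indicator {\<omega>. y \<in># gw x k \<omega>} \<omega> * (\<Prod>y\<in>#gw x k \<omega>. avoid off b n y) \<partial>gw_space off)"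
      by (intro emeasure_avoid adapted_gw) simp
    also have "\<dots> \<le> (\<integral>\<^sup>+\<omega>. avoid off b n y \<partial>gw_space off)"
      by (intro nn_integral_mono) (auto simp: indicator_def intro!: prod_mset_le_factor avoid_le_1)
    finally show ?thesis using emeasure_space_1 by simp
  qed
  then have "emeasure (gw_space off) ?A \<le> 0"
    by (intro LIMSEQ_le_const[OF assms]) auto
  then have "AE \<omega> in gw_space off. \<not> (y \<in># gw x k \<omega> \<and> (\<forall>i. b \<notin># gw x (k + i) \<omega>))"
    by (subst AE_iff_measurable[OF sets_gw_space_Collect]) (auto, measurable)
  then show "AE \<omega> in gw_space off. y \<in># gw x k \<omega> \<longrightarrow> (\<exists>i\<ge>k. b \<in># gw x i \<omega>)"
    by eventually_elim (metis le_add1)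
qed

section \<open>Parents, children and visits\<close>

definition child :: "('a \<Rightarrow> 'a multiset pmf) \<Rightarrow> 'a \<Rightarrow> 'a \<Rightarrow> bool" where
  "child off y c \<longleftrightarrow> (\<exists>M\<in>set_pmf (off y). c \<in># M)"

text \<open>On this almost sure event, arguments about genealogies become deterministic.\<close>

definition in_support ::
    "('a::countable \<Rightarrow> 'a multiset pmf) \<Rightarrow> (nat \<times> 'a \<times> nat \<Rightarrow> 'a multiset) \<Rightarrow> bool" where
  "in_support off \<omega> \<longleftrightarrow> (\<forall>n y k. \<omega> (n, y, k) \<in> set_pmf (off y))"

lemma AE_in_support:
  fixes off :: "'a::countable \<Rightarrow> 'a multiset pmf"
  shows "AE \<omega> in gw_space off. in_support off \<omega>"
  unfolding in_support_def AE_all_countable gw_space_def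
proof (intro allI)
  fix n k :: nat and y
  show "AE \<omega> in PiM UNIV (\<lambda>(n, y, k). measure_pmf (off y)). \<omega> (n, y, k) \<in> set_pmf (off y)"
    by (rule AE_PiM_component[of UNIV "\<lambda>(n, y, k). measure_pmf (off y)" "(n, y, k)", simplified])
       (auto split: prod.splits intro: prob_space_measure_pmf AE_measure_pmf)
qed

lemma in_gw_Suc_iff:
  "c \<in># gw x (Suc n) \<omega> \<longleftrightarrow> (\<exists>y k. k < count (gw x n \<omega>) y \<and> c \<in># \<omega> (n, y, k))"
proof -
  have "c \<in># gw x (Suc n) \<omega> \<longleftrightarrow>
      (\<exists>y\<in>set_mset (gw x n \<omega>). \<exists>k<count (gw x n \<omega>) y. c \<in># \<omega> (n, y, k))"
    by (simp add: set_mset_sum Bex_def)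
  then show ?thesis
    by (metis count_eq_zero_iff not_less_zero)
qed

lemma gw_Suc_parent:
  assumes "in_support off \<omega>" "c \<in># gw x (Suc n) \<omega>"
  obtains y where "y \<in># gw x n \<omega>" "child off y c"
proof -
  obtain y k where "k < count (gw x n \<omega>) y" "c \<in># \<omega> (n, y, k)"
    using assms(2) by (auto simp: in_gw_Suc_iff simp del: gw.simps)
  with assms(1) that[of y] show thesis
    by (auto simp: in_support_def child_def simp flip: count_greater_zero_iff intro: le_less_trans)
qed

lemma gw_Suc_certain_child:
  assumes "in_support off \<omega>" "y \<in># gw x n \<omega>" "\<And>M. M \<in> set_pmf (off y) \<Longrightarrow> c \<in># M"
  shows "c \<in># gw x (Suc n) \<omega>"
  using assms unfolding in_gw_Suc_iff in_support_def
  by (intro exI[of _ y] exI[of _ 0]) auto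

text \<open>Applied to the types \<open>(k, 0), (k + 1, 0), \<dots>\<close>: each is fed by its
  predecessor only, so the number of individuals along such a chain never grows.\<close>

lemma count_gw_Suc_le:
  assumes "in_support off \<omega>" "\<And>y'. child off y' c \<Longrightarrow> y' = y"
    and "\<And>M. M \<in> set_pmf (off y) \<Longrightarrow> count M c \<le> 1"
  shows "count (gw x (Suc n) \<omega>) c \<le> count (gw x n \<omega>) y"
proof -
  have "count (\<omega> (n, y', k)) c \<le> (if y' = y then 1 else 0)" for y' k
  proof (cases "y' = y")
    case False
    then have "c \<notin># \<omega> (n, y', k)"
      using assms(1,2) unfolding in_support_def child_def by blast
    then show ?thesis by (simp add: not_in_iff)
  qed (use assms in \<open>auto simp: in_support_def\<close>)
  then have "count (gw x (Suc n) \<omega>) c \<le>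
      (\<Sum>y'\<in>set_mset (gw x n \<omega>). \<Sum>k<count (gw x n \<omega>) y'. if y' = y then 1 else 0)"
    unfolding gw.simps count_sum by (intro sum_mono)
  also have "\<dots> \<le> count (gw x n \<omega>) y"
    by (simp add: if_distrib[of "\<lambda>t. _ * t"] sum.delta cong: if_cong)
  finally show ?thesis .
qed

lemma prob_complement_child:
  "measure_pmf.prob (off y) {M. z \<notin># M} = 1 - measure_pmf.prob (off y) {M. z \<in># M}"
  using measure_pmf.prob_compl[of "{M. z \<in># M}" "off y"] by (simp add: Compl_eq_Diff_UNIV[symmetric] Collect_neg_eq)

text \<open>The conditional Borel-Cantelli lemma with a target that moves: \<open>y n\<close> may
  follow a path through the type space, and \<open>P\<close> selects the generations that count as
  trials.\<close>

lemma AE_children_infinitely_often: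
  fixes off :: "'a::countable \<Rightarrow> 'a multiset pmf"
  assumes "0 < c" "\<And>n. P n \<Longrightarrow> c \<le> measure_pmf.prob (off (y n)) {M. z n \<in># M}"
  shows "AE \<omega> in gw_space off. (\<exists>\<^sub>\<infinity>n. P n \<and> y n \<in># gw x n \<omega>) \<longrightarrow>
    (\<exists>\<^sub>\<infinity>n. P n \<and> z n \<in># gw x (Suc n) \<omega>)"
proof -
  have "AE \<omega> in gw_space off. (\<exists>\<^sub>\<infinity>n. P n \<and> y n \<in># gw x n \<omega>) \<longrightarrow>
    (\<exists>\<^sub>\<infinity>n. (P n \<and> y n \<in># gw x n \<omega>) \<and> z n \<in># gw x (Suc n) \<omega>)"
  proof (rule AE_trials_succeed_infinitely_often[OF _ _ assms(1), where x = x])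
    fix n E assume E: "adapted x n E" "\<And>\<omega>. E \<omega> \<Longrightarrow> P n \<and> y n \<in># gw x n \<omega>"
    show "measure (gw_space off) {\<omega>. E \<omega> \<and> z n \<notin># gw x (Suc n) \<omega>} \<le>
      (1 - c) * measure (gw_space off) {\<omega>. E \<omega>}"
    proof (cases "P n")
      case True
      have "measure (gw_space off) {\<omega>. E \<omega> \<and> z n \<notin># gw x (Suc n) \<omega>} \<le>
          measure_pmf.prob (off (y n)) {M. z n \<notin># M} * measure (gw_space off) {\<omega>. E \<omega>}"
        using E by (intro measure_avoid_type_Suc_le) auto
      also have "\<dots> \<le> (1 - c) * measure (gw_space off) {\<omega>. E \<omega>}"
        using assms(2)[OF True] by (intro mult_right_mono) (auto simp: prob_complement_child)
      finally show ?thesis .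
    next
      case False
      then have "E \<omega> \<longleftrightarrow> False" for \<omega> using E by auto
      then show ?thesis by simp
    qed
  qed (rule adapted_gw adapted_conj adapted_const; simp)+
  then show ?thesis
  proof eventually_elim
    case (elim \<omega>)
    show ?case
    proof
      assume "\<exists>\<^sub>\<infinity>n. P n \<and> y n \<in># gw x n \<omega>"
      with elim have "\<exists>\<^sub>\<infinity>n. (P n \<and> y n \<in># gw x n \<omega>) \<and> z n \<in># gw x (Suc n) \<omega>"
        by blast
      then show "\<exists>\<^sub>\<infinity>n. P n \<and> z n \<in># gw x (Suc n) \<omega>"
        by (rule INFM_mono) blast
    qed
  qed
qed

definition visits ::
    "'a::countable \<Rightarrow> 'a set \<Rightarrow> (nat \<times> 'a \<times> nat \<Rightarrow> 'a multiset) \<Rightarrow> bool" where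
  "visits x A \<omega> \<longleftrightarrow> (\<exists>\<^sub>\<infinity>n. \<exists>y\<in>A. y \<in># gw x n \<omega>)"

text \<open>A sequence of natural numbers tends to 0 only by being eventually 0.\<close>

lemma extinct_in_iff: "extinct_in x A \<omega> \<longleftrightarrow> \<not> visits x A \<omega>"
proof -
  have "extinct_in x A \<omega> \<longleftrightarrow> (\<forall>\<^sub>\<infinity>n. {#y \<in># gw x n \<omega>. y \<in> A#} = {#})"
    unfolding extinct_in_def
    by (subst tendsto_discrete) (simp add: cofinite_eq_sequentially)
  moreover have "{#y \<in># Z. y \<in> A#} = {#} \<longleftrightarrow> \<not> (\<exists>y\<in>A. y \<in># Z)" for Z
    by (auto simp: filter_mset_eq_conv)
  ultimately show ?thesis
    by (simp only: visits_def not_INFM)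
qed

lemma visits_mono: "visits x A \<omega> \<Longrightarrow> A \<subseteq> B \<Longrightarrow> visits x B \<omega>"
  unfolding visits_def by (auto elim!: INFM_mono)

lemma visits_finite_iff:
  assumes "finite A"
  shows "visits x A \<omega> \<longleftrightarrow> (\<exists>y\<in>A. visits x {y} \<omega>)"
  unfolding visits_def using assms by (simp add: INFM_finite_Bex_distrib)

lemma AE_visits_child:
  fixes off :: "'a::countable \<Rightarrow> 'a multiset pmf"
  assumes "child off y z"
  shows "AE \<omega> in gw_space off. visits x {y} \<omega> \<longrightarrow> visits x {z} \<omega>"
proof -
  have "0 < measure_pmf.prob (off y) {M. z \<in># M}"
    using assms by (auto simp: child_def measure_pmf_posI)
  from AE_children_infinitely_often[OF this, of "\<lambda>_. True" off "\<lambda>_. y" "\<lambda>_. z" x]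
  have "AE \<omega> in gw_space off. (\<exists>\<^sub>\<infinity>n. y \<in># gw x n \<omega>) \<longrightarrow> (\<exists>\<^sub>\<infinity>n. z \<in># gw x (Suc n) \<omega>)"
    by simp
  then show ?thesis
    unfolding visits_def cofinite_eq_sequentially frequently_def
    by eventually_elim (simp add: eventually_sequentially_Suc[of "\<lambda>n. z \<notin># gw x n _"] del: gw.simps)
qed

lemma AE_visits_reachable:
  assumes "(child off)\<^sup>*\<^sup>* y z"
  shows "AE \<omega> in gw_space off. visits x {y} \<omega> \<longrightarrow> visits x {z} \<omega>"
  using assms
proof induction
  case (step z z')
  from step.IH AE_visits_child[OF step.hyps(2), of x] show ?case by eventually_elim auto
qed simp

lemma pred_visits [measurable]: "Measurable.pred (gw_space off) (visits x A)"
  unfolding visits_def INFM_nat by measurable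

lemma avoid_antimono: "m \<le> n \<Longrightarrow> avoid off b n y \<le> avoid off b m y"
  unfolding emeasure_avoid_start[symmetric]
  by (intro emeasure_mono sets_gw_space_Collect) (auto, measurable)

lemma measure_litter:
  fixes off :: "'a::countable \<Rightarrow> 'a multiset pmf"
  shows "{\<omega>. \<omega> (n, y, k) \<in> S} \<in> sets (gw_space off)"
    and "measure (gw_space off) {\<omega>. \<omega> (n, y, k) \<in> S} = measure_pmf.prob (off y) S"
proof -
  let ?N = "\<lambda>(n::nat, y, k::nat). measure_pmf (off y)"
  have m: "(\<lambda>\<omega>. \<omega> (n, y, k)) \<in> measurable (gw_space off) (measure_pmf (off y))"
    using measurable_component_singleton[of "(n, y, k)" UNIV ?N] by (simp add: gw_space_def)
  have eq: "{\<omega>. \<omega> (n, y, k) \<in> S} = (\<lambda>\<omega>. \<omega> (n, y, k)) -` S \<inter> space (gw_space off)"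
    by auto
  show "{\<omega>. \<omega> (n, y, k) \<in> S} \<in> sets (gw_space off)"
    unfolding eq by (rule measurable_sets[OF m]) simp
  have "measure_pmf (off y) = distr (gw_space off) (measure_pmf (off y)) (\<lambda>\<omega>. \<omega> (n, y, k))"
    unfolding gw_space_def
    by (subst distr_PiM_component[of UNIV ?N "(n, y, k)", simplified])
       (auto split: prod.splits intro: prob_space_measure_pmf)
  then have "measure_pmf.prob (off y) S =
      measure (distr (gw_space off) (measure_pmf (off y)) (\<lambda>\<omega>. \<omega> (n, y, k))) S"
    by simp
  also have "\<dots> = measure (gw_space off) {\<omega>. \<omega> (n, y, k) \<in> S}"
    unfolding eq by (rule measure_distr[OF m]) simp
  finally show "measure (gw_space off) {\<omega>. \<omega> (n, y, k) \<in> S} = measure_pmf.prob (off y) S" ..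
qed

section \<open>The process on the grid\<close>

text \<open>A geometric series. The generating function is fractional linear, which gives
  \<open>miss_Suc_line_Suc\<close> its simple closed form.\<close>

lemma nn_integral_power_geometric_mean:
  assumes "0 < m" "0 \<le> s" "s \<le> 1"
  shows "(\<integral>\<^sup>+k. ennreal s ^ k \<partial>measure_pmf (geometric_mean_pmf m)) = ennreal (1 / (1 + m * (1 - s)))"
proof -
  have lt: "m / (1 + m) * s < 1"
  proof -
    have "m / (1 + m) * s \<le> m / (1 + m) * 1"
      using assms by (intro mult_left_mono) auto
    also have "\<dots> < 1" using assms by simp
    finally show ?thesis .
  qed
  have "(\<lambda>k. 1 / (1 + m) * (m / (1 + m) * s) ^ k) sums (1 / (1 + m) * (1 / (1 - m / (1 + m) * s)))"
    using assms lt by (intro sums_mult geometric_sums) auto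
  moreover have "1 / (1 + m) * (1 / (1 - m / (1 + m) * s)) = 1 / (1 + m * (1 - s))"
    using assms lt by (simp add: divide_simps) (simp add: algebra_simps)
  ultimately have sums: "(\<lambda>k. 1 / (1 + m) * (m / (1 + m) * s) ^ k) sums (1 / (1 + m * (1 - s)))"
    by simp
  have "(\<integral>\<^sup>+k. ennreal s ^ k \<partial>measure_pmf (geometric_mean_pmf m)) =
      (\<Sum>k. ennreal (1 / (1 + m) * (m / (1 + m) * s) ^ k))"
    using assms
    by (simp add: nn_integral_measure_pmf nn_integral_count_space_nat pmf_geometric_mean
        ennreal_power power_mult_distrib power_divide ennreal_mult'[symmetric] mult.assoc)
  also have "\<dots> = ennreal (1 / (1 + m * (1 - s)))"
    using assms by (intro suminf_ennreal_eq sums) auto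
  finally show ?thesis .
qed

lemma prob_geometric_mean_pos:
  assumes "0 < m"
  shows "measure_pmf.prob (geometric_mean_pmf m) {k. 0 < k} = m / (1 + m)"
proof -
  have "measure_pmf.prob (geometric_mean_pmf m) {k. 0 < k} =
      1 - measure_pmf.prob (geometric_mean_pmf m) {0}"
  proof -
    have "{k :: nat. 0 < k} = UNIV - {0}" by auto
    then show ?thesis
      using measure_pmf.prob_compl[of "{0}" "geometric_mean_pmf m"] by simp
  qed
  then show ?thesis
    using assms by (simp add: measure_pmf_single pmf_geometric_mean field_simps)
qed

section \<open>The index \<open>iota\<close>\<close>

lemma iota_eq_enatD:
  assumes "iota A = enat i"
  shows "infinite (line i \<inter> A)" "\<And>l. l < i \<Longrightarrow> finite (line l \<inter> A)"
proof -
  let ?S = "{enat i | i. infinite (line i \<inter> A)}"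
  have "?S \<noteq> {}"
    using assms unfolding iota_def by (metis Inf_empty enat.distinct(1) top_enat_def)
  then have "Inf ?S \<in> ?S" by (meson equals0I wellorder_InfI)
  then show "infinite (line i \<inter> A)" using assms by (auto simp: iota_def)
  fix l assume "l < i"
  show "finite (line l \<inter> A)"
  proof (rule ccontr)
    assume "infinite (line l \<inter> A)"
    then have "Inf ?S \<le> enat l" by (intro Inf_lower) blast
    with assms \<open>l < i\<close> show False by (simp add: iota_def)
  qed
qed

lemma iota_eq_infinityD: "iota A = \<infinity> \<Longrightarrow> finite (line l \<inter> A)"
proof (rule ccontr)
  assume *: "iota A = \<infinity>" "infinite (line l \<inter> A)"
  then have "iota A \<le> enat l" unfolding iota_def by (intro Inf_lower) blast
  with *(1) show False by simp
qed

lemma iota_line: "iota (line i) = enat i"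
proof -
  have "line l \<inter> line i = {}" if "l \<noteq> i" for l using that by (auto simp: line_def)
  moreover have "infinite (line i)"
  proof -
    have "line i = range (Pair i)" by (auto simp: line_def)
    then show ?thesis by (simp add: finite_image_iff inj_on_def)
  qed
  ultimately have "infinite (line l \<inter> line i) \<longleftrightarrow> l = i" for l
    by (cases "l = i") simp_all
  then have "{enat l | l. infinite (line l \<inter> line i)} = {enat i}"
    by simp
  then show ?thesis by (simp only: iota_def cInf_singleton)
qed

section \<open>Irreducibility and motion along the lines\<close>

locale grid_process =
  fixes p q r :: real
  assumes p: "0 < p" "p < 1" and q: "0 < q" "q < 1" and r: "0 < r"
begin

abbreviation "off \<equiv> offspring p q r"
abbreviation "Om \<equiv> gw_space (offspring p q r)"

sublocale prob_space Om
  by (rule prob_space_gw_space)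

lemma mean_pos: "0 < r powi k"
  using r by simp

lemma set_geometric_mean: "0 < m \<Longrightarrow> set_pmf (geometric_mean_pmf m) = UNIV"
  unfolding geometric_mean_pmf_def by (intro set_pmf_geometric) auto

lemma child_simps:
  "child off (0, 0) c \<longleftrightarrow> c = (1, 0)"
  "child off (0, Suc j) c \<longleftrightarrow> c = (0, j)"
  "child off (Suc i, 0) c \<longleftrightarrow> c = (Suc i, 1) \<or> c = (Suc (Suc i), 0)"
  "child off (Suc i, Suc j) c \<longleftrightarrow> c = (i, Suc j) \<or> c = (Suc i, Suc (Suc j))"
proof -
  show "child off (0, 0) c \<longleftrightarrow> c = (1, 0)" "child off (0, Suc j) c \<longleftrightarrow> c = (0, j)"
    "child off (Suc i, 0) c \<longleftrightarrow> c = (Suc i, 1) \<or> c = (Suc (Suc i), 0)"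
    using p q by (auto simp: child_def UNIV_bool)
  show "child off (Suc i, Suc j) c \<longleftrightarrow> c = (i, Suc j) \<or> c = (Suc i, Suc (Suc j))"
    using set_geometric_mean[OF mean_pos, of "1 - int (Suc j)"]
    by (auto simp: child_def intro: exI[of _ 1])
qed

lemma child_cases:
  assumes "child off y c"
  obtains "y = (0, 0)" "c = (1, 0)" | j where "y = (0, Suc j)" "c = (0, j)"
  | i where "y = (Suc i, 0)" "c = (Suc i, 1)" | i where "y = (Suc i, 0)" "c = (Suc (Suc i), 0)"
  | i j where "y = (Suc i, Suc j)" "c = (i, Suc j)"
  | i j where "y = (Suc i, Suc j)" "c = (Suc i, Suc (Suc j))"
proof -
  obtain i j where "y = (i, j)" by (cases y)
  with assms that show thesis
    by (cases i; cases j) (auto simp: child_simps)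
qed

lemma reachable: "(child off)\<^sup>*\<^sup>* y z"
proof -
  have up: "(child off)\<^sup>*\<^sup>* (0, 0) (i, 0)" for i
  proof (induction i)
    case (Suc i)
    have "child off (i, 0) (Suc i, 0)" by (cases i) (auto simp: child_simps)
    with Suc show ?case by auto
  qed simp
  have right: "(child off)\<^sup>*\<^sup>* (Suc i, 0) (Suc i, j)" for i j
  proof (induction j)
    case (Suc j)
    have "child off (Suc i, j) (Suc i, Suc j)" by (cases j) (auto simp: child_simps)
    with Suc show ?case by auto
  qed simp
  have left: "(child off)\<^sup>*\<^sup>* (0, j) (0, 0)" for j
  proof (induction j)
    case (Suc j)
    have "child off (0, Suc j) (0, j)" by (auto simp: child_simps)
    with Suc show ?case by (meson converse_rtranclp_into_rtranclp)
  qed simp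
  have down: "(child off)\<^sup>*\<^sup>* (i, Suc j) (0, Suc j)" for i j
  proof (induction i)
    case (Suc i)
    have "child off (Suc i, Suc j) (i, Suc j)" by (auto simp: child_simps)
    with Suc show ?case by (meson converse_rtranclp_into_rtranclp)
  qed simp
  have to0: "(child off)\<^sup>*\<^sup>* y (0, 0)"
  proof (cases y)
    case (Pair i j)
    show ?thesis
    proof (cases j)
      case (Suc j')
      show ?thesis unfolding Pair Suc using down left by (meson rtranclp_trans)
    next
      case 0
      show ?thesis
      proof (cases i)
        case (Suc i')
        \<comment> \<open>On a line \<open>i \<ge> 1\<close> the type in column 0 has no child on a
          lower line, so the route first moves to column 1.\<close>
        show ?thesis unfolding Pair 0 Suc using right[of i' "Suc 0"] down left by (meson rtranclp_trans)
      qed (simp add: Pair 0)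
    qed
  qed
  have "(child off)\<^sup>*\<^sup>* (0, 0) z"
  proof (cases z)
    case (Pair i j)
    show ?thesis
    proof (cases i)
      case (Suc i')
      show ?thesis unfolding Pair Suc using right up by (meson rtranclp_trans)
    next
      case 0
      have "(child off)\<^sup>*\<^sup>* (0, 0) (0, Suc j)"
        using up[of "Suc 0"] right[of 0 "Suc j"] down[of "Suc 0" j] by (meson rtranclp_trans)
      moreover have "child off (0, Suc j) (0, j)" by (auto simp: child_simps)
      ultimately show ?thesis unfolding Pair 0 by auto
    qed
  qed
  with to0 show ?thesis by (meson rtranclp_trans)
qed

lemma AE_visits_all: "AE \<omega> in Om. \<forall>y z. visits x {y} \<omega> \<longrightarrow> visits x {z} \<omega>"
  unfolding AE_all_countable using AE_visits_reachable[OF reachable] by blast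

lemma gw_line_Suc:
  assumes "in_support off \<omega>" "(Suc i, j) \<in># gw x n \<omega>"
  shows "(Suc i, j + t) \<in># gw x (n + t) \<omega>"
proof (induction t)
  case (Suc t)
  have "(Suc i, Suc (j + t)) \<in># gw x (Suc (n + t)) \<omega>"
    by (rule gw_Suc_certain_child[OF assms(1) Suc.IH]) (cases "j + t"; auto)
  then show ?case by (simp del: gw.simps)
qed (use assms in simp)

lemma prob_child_down:
  "measure_pmf.prob (off (Suc i, Suc j)) {M. (i, Suc j) \<in># M} = r powi - int j / (1 + r powi - int j)"
proof -
  have "(\<lambda>k. replicate_mset k (i, Suc j) + {#(Suc i, Suc j + 1)#}) -` {M. (i, Suc j) \<in># M} = {k. 0 < k}"
    by auto
  then show ?thesis
    using prob_geometric_mean_pos[OF mean_pos, of "- int j"] by simp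
qed

text \<open>For \<open>r \<le> 1\<close> the mean number of lower children in every column
  \<open>\<ge> 1\<close> is at least 1, so there is such a child with probability at least
  \<open>1 / 2\<close>. The line passes above all but finitely many points of
  \<open>line k \<inter> A\<close>, which gives infinitely many trials.\<close>

lemma AE_line_feeds_lower_line:
  assumes "r \<le> 1" "infinite (line k \<inter> A)"
  shows "AE \<omega> in Om. \<forall>j n. (Suc k, j) \<in># gw x n \<omega> \<longrightarrow> visits x (line k \<inter> A) \<omega>"
  unfolding AE_all_countable
proof (intro allI)
  fix j0 n0 :: nat
  \<comment> \<open>\<open>s n\<close> is the column in which the rightward descendant of
    \<open>(Suc k, j0)\<close> stands in generation \<open>n\<close>. \<open>P\<close> requires
    \<open>0 < s n\<close> because column 0 has no lower children.\<close>
  define s where "s n = j0 + (n - n0)" for n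
  define P where "P n \<longleftrightarrow> n0 \<le> n \<and> 0 < s n \<and> (k, s n) \<in> A" for n
  have inf: "infinite {n. P n}"
  proof
    assume fin: "finite {n. P n}"
    have "line k \<inter> A \<subseteq> Pair k ` ({..j0} \<union> s ` {n. P n})"
    proof
      fix y assume y: "y \<in> line k \<inter> A"
      then obtain j where j: "y = (k, j)" by (auto simp: line_def)
      have "j \<in> {..j0} \<union> s ` {n. P n}"
      proof (cases "j \<le> j0")
        case False
        then have "j = s (n0 + (j - j0))" "P (n0 + (j - j0))"
          using y j by (auto simp: s_def P_def)
        then show ?thesis by blast
      qed simp
      with j show "y \<in> Pair k ` ({..j0} \<union> s ` {n. P n})" by blast
    qed
    with fin assms(2) show False
      by (meson finite_Un finite_atMost finite_imageI finite_subset)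
  qed
  have ge: "1 / 2 \<le> measure_pmf.prob (off (Suc k, s n)) {M. (k, s n) \<in># M}" if n: "P n" for n
  proof -
    obtain j where j: "s n = Suc j" using n by (cases "s n") (auto simp: P_def)
    have "1 \<le> r powi - int j"
      using assms(1) r by (simp add: power_int_minus one_le_inverse power_le_one)
    then show ?thesis
      unfolding j prob_child_down by (simp add: field_simps)
  qed
  have "AE \<omega> in Om. (\<exists>\<^sub>\<infinity>n. P n \<and> (Suc k, s n) \<in># gw x n \<omega>) \<longrightarrow>
      (\<exists>\<^sub>\<infinity>n. P n \<and> (k, s n) \<in># gw x (Suc n) \<omega>)"
    by (rule AE_children_infinitely_often[of "1 / 2"]) (use ge in auto)
  then show "AE \<omega> in Om. (Suc k, j0) \<in># gw x n0 \<omega> \<longrightarrow> visits x (line k \<inter> A) \<omega>"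
    using AE_in_support[of off]
  proof eventually_elim
    case (elim \<omega>)
    show ?case
    proof
      assume *: "(Suc k, j0) \<in># gw x n0 \<omega>"
      have "(Suc k, s n) \<in># gw x n \<omega>" if "P n" for n
        using gw_line_Suc[OF elim(2) *, of "n - n0"] that by (simp add: P_def s_def)
      then have "\<exists>\<^sub>\<infinity>n. P n \<and> (Suc k, s n) \<in># gw x n \<omega>"
        using inf unfolding INFM_iff_infinite by (simp cong: conj_cong)
      with elim have inf2: "\<exists>\<^sub>\<infinity>n. P n \<and> (k, s n) \<in># gw x (Suc n) \<omega>"
        by simp
      show "visits x (line k \<inter> A) \<omega>"
        unfolding visits_def INFM_nat_le
      proof
        fix m
        from inf2 obtain n where "m \<le> n" "P n" "(k, s n) \<in># gw x (Suc n) \<omega>"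
          unfolding INFM_nat_le by blast
        then show "\<exists>n\<ge>m. \<exists>y\<in>line k \<inter> A. y \<in># gw x n \<omega>"
          by (intro exI[of _ "Suc n"] conjI bexI[of _ "(k, s n)"])
             (auto simp: P_def line_def simp del: gw.simps)
      qed
    qed
  qed
qed

subsection \<open>Hitting the origin\<close>

definition miss :: "nat \<Rightarrow> nat \<times> nat \<Rightarrow> real" where
  "miss n y = enn2real (avoid off (0, 0) n y)"

lemma avoid_eq_miss: "avoid off (0, 0) n y = ennreal (miss n y)"
  unfolding miss_def using avoid_le_1[of off "(0, 0)" n y]
  by (intro ennreal_enn2real[symmetric]) (auto simp: le_less_trans)

lemma miss_nonneg: "0 \<le> miss n y"
  by (simp add: miss_def)

lemma miss_le_1: "miss n y \<le> 1"
  using avoid_le_1[of off "(0, 0)" n y] by (simp add: avoid_eq_miss)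

lemma miss_antimono: "m \<le> n \<Longrightarrow> miss n y \<le> miss m y"
  using avoid_antimono[of m n off "(0, 0)" y] by (simp add: avoid_eq_miss miss_nonneg)

lemma miss_0: "y \<noteq> (0, 0) \<Longrightarrow> miss 0 y = 1"
  by (simp add: miss_def)

lemma miss_origin: "miss n (0, 0) = 0"
  by (cases n) (simp_all add: miss_def)

lemma miss_Suc_line_0: "miss (Suc n) (0, Suc j) = 1 - p + p * miss n (0, j)"
proof -
  have "ennreal (miss (Suc n) (0, Suc j)) = ennreal (miss n (0, j)) * ennreal p + ennreal (1 - p)"
    using p by (simp add: avoid_eq_miss[symmetric])
  also have "\<dots> = ennreal (1 - p + p * miss n (0, j))"
    using p miss_nonneg by (simp add: ennreal_mult'[symmetric] ennreal_plus[symmetric] algebra_simps del: ennreal_plus)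
  finally show ?thesis
    using p miss_nonneg by (subst (asm) ennreal_inj) auto
qed

text \<open>The numerator belongs to the certain child on the right, the denominator to the
  geometric number of children on line \<open>i\<close>, each of which must miss the origin.\<close>

lemma miss_Suc_line_Suc:
  "miss (Suc n) (Suc i, Suc j) =
    miss n (Suc i, Suc (Suc j)) / (1 + (1 / r) ^ j * (1 - miss n (i, Suc j)))"
proof -
  have m: "r powi - int j = (1 / r) ^ j"
    by (simp add: power_int_minus power_one_over inverse_eq_divide)
  have "(\<integral>\<^sup>+k. ennreal (miss n (i, Suc j)) ^ k \<partial>measure_pmf (geometric_mean_pmf (r powi - int j))) =
      ennreal (1 / (1 + (1 / r) ^ j * (1 - miss n (i, Suc j))))"
    unfolding m using r by (intro nn_integral_power_geometric_mean miss_nonneg miss_le_1) simp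
  then have "ennreal (miss (Suc n) (Suc i, Suc j)) =
      ennreal (miss n (Suc i, Suc (Suc j))) * ennreal (1 / (1 + (1 / r) ^ j * (1 - miss n (i, Suc j))))"
    by (simp add: avoid_eq_miss[symmetric] nn_integral_cmult)
  also have "\<dots> = ennreal (miss n (Suc i, Suc (Suc j)) / (1 + (1 / r) ^ j * (1 - miss n (i, Suc j))))"
    by (subst ennreal_mult'[symmetric]) (auto simp: miss_nonneg)
  finally show ?thesis
    using r miss_nonneg miss_le_1 by (subst (asm) ennreal_inj) (auto intro!: divide_nonneg_nonneg add_nonneg_nonneg)
qed

lemma le_power_pred: "r \<le> 1 \<Longrightarrow> p \<le> r ^ Suc i \<Longrightarrow> p \<le> r ^ i"
  using r by (smt (verit) power_Suc_le_self power_Suc mult_left_le_one_le zero_le_power)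

text \<open>
  Only the children that the individual itself has on the next lower line are used, not those further
  along its own line; this already gives the order \<open>(p / r ^ i) ^ j\<close> of the mean number of hits.
\<close>

lemma hit_probability_ge:
  assumes "r \<le> 1" "p \<le> r ^ i"
  shows "\<exists>c. 0 < c \<and> c \<le> 1 \<and> (\<forall>j. \<exists>n. c * (p / r ^ i) ^ Suc j \<le> 1 - miss n (i, Suc j))"
  using assms(2)
proof (induction i)
  case 0
  \<comment> \<open>From \<open>(0, n)\<close> the origin can only be reached in generation
    \<open>n\<close>, by \<open>n\<close> successful steps to the left.\<close>
  have "miss n (0, n) = 1 - p ^ n" for n
    by (induction n) (simp_all add: miss_origin miss_Suc_line_0 right_diff_distrib)
  then have "\<exists>n. 1 * (p / r ^ 0) ^ Suc j \<le> 1 - miss n (0, Suc j)" for j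
    by (intro exI[of _ "Suc j"]) simp
  then show ?case
    by (intro exI[of _ 1]) auto
next
  case (Suc i)
  then obtain c where c: "0 < c" "c \<le> 1" and hit: "\<And>j. \<exists>n. c * (p / r ^ i) ^ Suc j \<le> 1 - miss n (i, Suc j)"
    using le_power_pred[OF assms(1)] by blast
  define a where "a = p / r ^ Suc i"
  have a: "0 < a" "a \<le> 1" using Suc.prems p r by (auto simp: a_def)
  have "\<exists>n. c * r / 2 * a ^ Suc j \<le> 1 - miss n (Suc i, Suc j)" for j
  proof -
    obtain n where n: "c * (p / r ^ i) ^ Suc j \<le> 1 - miss n (i, Suc j)"
      using hit by blast
    \<comment> \<open>\<open>h\<close> is the mean number of lower children times their chance to
      hit, and \<open>e\<close> is the lower bound for it from the induction hypothesis. As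
      \<open>e \<le> 1\<close>, the hitting probability is at least
      \<open>e / (1 + e) \<ge> e / 2\<close>. The factor \<open>r\<close> in the new constant
      appears because the mean in column \<open>j + 1\<close> is \<open>(1 / r) ^ j\<close>.\<close>
    define e where "e = (1 / r) ^ j * (c * (p / r ^ i) ^ Suc j)"
    define h where "h = (1 / r) ^ j * (1 - miss n (i, Suc j))"
    have e: "e = c * r * a ^ Suc j"
      using r by (simp add: e_def a_def power_divide power_mult_distrib field_simps)
    have "a ^ Suc j \<le> 1" using a by (intro power_le_one) auto
    then have "c * r * a ^ Suc j \<le> 1 * 1 * 1"
      using c r assms(1) a by (intro mult_mono) auto
    then have "0 < e" "e \<le> 1" using c r a by (auto simp: e)
    moreover have eh: "e \<le> h"
      unfolding e_def h_def using n r by (intro mult_left_mono) auto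
    ultimately have "e / 2 \<le> 1 - 1 / (1 + e)"
      by (simp add: field_simps)
    also have "\<dots> \<le> 1 - 1 / (1 + h)"
      using eh \<open>0 < e\<close> by (simp add: frac_le)
    also have "\<dots> \<le> 1 - miss (Suc n) (Suc i, Suc j)"
      unfolding miss_Suc_line_Suc h_def[symmetric]
      using eh \<open>0 < e\<close> miss_le_1 by (intro diff_left_mono divide_right_mono) auto
    finally show ?thesis
      by (intro exI[of _ "Suc n"]) (simp add: e)
  qed
  then show ?case
    unfolding a_def[symmetric]
    using c r assms(1) mult_mono[of c 1 r 1] by (intro exI[of _ "c * r / 2"]) auto
qed

text \<open>Here \<open>p / r ^ Suc i \<ge> 1\<close>, so the lower bound for hitting through lower
  children does not decay with the column. Each step to the right multiplies the chance to miss by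
  at most \<open>1 / (1 + d)\<close>, and the line has infinitely many steps.\<close>

lemma miss_critical_line_tendsto_0:
  assumes "r \<le> 1" "p \<le> r ^ i" "r ^ Suc i \<le> p"
  shows "(\<lambda>n. miss n (Suc i, Suc j)) \<longlonglongrightarrow> 0"
proof -
  obtain c where c: "0 < c" "c \<le> 1" and hit: "\<And>j. \<exists>n. c * (p / r ^ i) ^ Suc j \<le> 1 - miss n (i, Suc j)"
    using hit_probability_ge[OF assms(1,2)] by blast
  define d where "d = c * r"
  have d: "0 < d" using c r by (simp add: d_def)
  have step: "\<exists>n. \<forall>m\<ge>n. miss (Suc m) (Suc i, Suc j) \<le> miss m (Suc i, Suc (Suc j)) / (1 + d)" for j
  proof -
    obtain n where n: "c * (p / r ^ i) ^ Suc j \<le> 1 - miss n (i, Suc j)"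
      using hit by blast
    have "miss (Suc m) (Suc i, Suc j) \<le> miss m (Suc i, Suc (Suc j)) / (1 + d)" if "m \<ge> n" for m
    proof -
      have "1 \<le> (p / r ^ Suc i) ^ Suc j"
        using assms(3) r by (intro one_le_power) (auto simp: field_simps)
      then have "d \<le> d * (p / r ^ Suc i) ^ Suc j"
        using d mult_left_mono[of 1 _ d] by fastforce
      also have "\<dots> = (1 / r) ^ j * (c * (p / r ^ i) ^ Suc j)"
        using r by (simp add: d_def power_divide power_mult_distrib field_simps)
      also have "\<dots> \<le> (1 / r) ^ j * (1 - miss m (i, Suc j))"
        using n miss_antimono[OF that, of "(i, Suc j)"] r by (intro mult_left_mono) auto
      finally show ?thesis
        unfolding miss_Suc_line_Suc using d miss_nonneg by (intro divide_left_mono) auto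
    qed
    then show ?thesis by blast
  qed
  \<comment> \<open>The generation needed depends on both \<open>t\<close> and the column;
    monotonicity in the generation allows passing to the larger of two.\<close>
  have small: "\<exists>n. miss n (Suc i, Suc j) \<le> (1 / (1 + d)) ^ t" for t j
  proof (induction t arbitrary: j)
    case 0
    show ?case using miss_le_1 by auto
  next
    case (Suc t)
    obtain n1 where n1: "miss n1 (Suc i, Suc (Suc j)) \<le> (1 / (1 + d)) ^ t"
      using Suc by blast
    obtain n2 where n2: "\<And>m. m \<ge> n2 \<Longrightarrow> miss (Suc m) (Suc i, Suc j) \<le> miss m (Suc i, Suc (Suc j)) / (1 + d)"
      using step by blast
    have "miss (Suc (max n1 n2)) (Suc i, Suc j) \<le> miss (max n1 n2) (Suc i, Suc (Suc j)) / (1 + d)"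
      by (rule n2) simp
    also have "\<dots> \<le> (1 / (1 + d)) ^ t / (1 + d)"
      using d n1 miss_antimono[of n1 "max n1 n2" "(Suc i, Suc (Suc j))"] by (intro divide_right_mono) auto
    finally show ?case by (intro exI[of _ "Suc (max n1 n2)"]) simp
  qed
  show ?thesis
  proof (rule LIMSEQ_I)
    fix e :: real assume "0 < e"
    obtain t where t: "(1 / (1 + d)) ^ t < e"
      using real_arch_pow_inv[of e "1 / (1 + d)"] \<open>0 < e\<close> d by auto
    obtain n where n: "miss n (Suc i, Suc j) \<le> (1 / (1 + d)) ^ t"
      using small by blast
    have "norm (miss m (Suc i, Suc j) - 0) < e" if "n \<le> m" for m
      using miss_antimono[OF that, of "(Suc i, Suc j)"] n t miss_nonneg[of m "(Suc i, Suc j)"] by simp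
    then show "\<exists>n. \<forall>m\<ge>n. norm (miss m (Suc i, Suc j) - 0) < e" by blast
  qed
qed

text \<open>The left side is a subsolution of the recursion for \<open>miss\<close>: the loss
  \<open>h\<close> through lower children is at most the decrease of \<open>C' * a ^ Suc j\<close>
  from one column to the next, where \<open>a < 1\<close>.\<close>

lemma miss_ge:
  assumes "r \<le> 1" "p < r ^ i"
  shows "\<exists>C\<ge>0. \<forall>n j. 1 - C * (p / r ^ i) ^ Suc j \<le> miss n (i, Suc j)"
  using assms(2)
proof (induction i)
  case 0
  have *: "1 - p ^ j \<le> miss n (0, j)" for n j
  proof (induction n arbitrary: j)
    case 0
    show ?case using p by (cases j) (auto simp: miss_0 miss_origin)
  next
    case (Suc n)
    show ?case
    proof (cases j)
      case (Suc j')
      have "p * (1 - p ^ j') \<le> p * miss n (0, j')"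
        using Suc.IH p by (intro mult_left_mono) auto
      then show ?thesis by (simp add: Suc miss_Suc_line_0 algebra_simps)
    qed (simp add: miss_origin)
  qed
  show ?case
    using * by (intro exI[of _ 1]) (simp flip: power_Suc)
next
  case (Suc i)
  have "r ^ Suc i \<le> r ^ i" using assms(1) r by (intro power_decreasing) auto
  then obtain C where C: "0 \<le> C" and le: "\<And>n j. 1 - C * (p / r ^ i) ^ Suc j \<le> miss n (i, Suc j)"
    using Suc by auto
  define a where "a = p / r ^ Suc i"
  have a: "0 < a" "a < 1" using Suc.prems p r by (auto simp: a_def)
  \<comment> \<open>Chosen so that \<open>C * r * a ^ Suc j\<close> equals
    \<open>C' * a ^ Suc j - C' * a ^ Suc (Suc j)\<close>, which makes the bounds telescope.\<close>
  define C' where "C' = C * r / (1 - a)"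
  have C': "0 \<le> C'" using C r a by (simp add: C'_def)
  have "1 - C' * a ^ Suc j \<le> miss n (Suc i, Suc j)" for n j
  proof (induction n arbitrary: j)
    case 0
    show ?case using C' a by (simp add: miss_0)
  next
    case (Suc n)
    define h where "h = (1 / r) ^ j * (1 - miss n (i, Suc j))"
    have h: "0 \<le> h" using r miss_le_1 by (simp add: h_def)
    have "h \<le> (1 / r) ^ j * (C * (p / r ^ i) ^ Suc j)"
      unfolding h_def using le[of j n] r by (intro mult_left_mono) auto
    also have "\<dots> = C * r * a ^ Suc j"
      using r by (simp add: a_def power_divide power_mult_distrib field_simps)
    also have "\<dots> = C' * (1 - a) * a ^ Suc j"
      using a by (simp add: C'_def)
    finally have hle: "h \<le> C' * a ^ Suc j - C' * a ^ Suc (Suc j)"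
      by (simp add: algebra_simps)
    show ?case
    \<comment> \<open>If the bound for the next column is trivial, so is the one for this column.
      Otherwise \<open>1 - X\<close> is positive and the estimate
      \<open>1 - h \<le> 1 / (1 + h)\<close> may be multiplied by it.\<close>
    proof (cases "1 \<le> C' * a ^ Suc (Suc j)")
      case True
      then have "1 - C' * a ^ Suc j \<le> 0" using hle h by linarith
      also have "0 \<le> miss (Suc n) (Suc i, Suc j)" by (rule miss_nonneg)
      finally show ?thesis .
    next
      case False
      define X where "X = C' * a ^ Suc (Suc j)"
      have X: "0 \<le> X" "X < 1" using False C' a by (auto simp: X_def)
      have "1 - C' * a ^ Suc j \<le> 1 - X - h" using hle by (simp add: X_def)
      also have "\<dots> \<le> (1 - X) * (1 - h)" using X h by (simp add: algebra_simps)
      also have "\<dots> \<le> (1 - X) * (1 / (1 + h))"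
        using X h by (intro mult_left_mono) (auto simp: field_simps)
      also have "\<dots> \<le> miss n (Suc i, Suc (Suc j)) * (1 / (1 + h))"
        using Suc.IH[of "Suc j"] h by (intro mult_right_mono) (auto simp: X_def)
      finally show ?thesis by (simp add: miss_Suc_line_Suc h_def)
    qed
  qed
  with C' show ?case unfolding a_def by blast
qed

lemma prob_never_origin_positive:
  assumes "r \<le> 1" "p < r ^ i"
  shows "\<exists>j. 0 < prob {\<omega>. \<forall>n. (0, 0) \<notin># gw (i, Suc j) n \<omega>}"
proof -
  obtain C where C: "0 \<le> C" and le: "\<And>n j. 1 - C * (p / r ^ i) ^ Suc j \<le> miss n (i, Suc j)"
    using miss_ge[OF assms] by blast
  define x where "x = p / r ^ i"
  have x: "0 < x" "x < 1" using assms p r by (auto simp: x_def)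
  \<comment> \<open>Far enough to the right the lower bound exceeds \<open>1 / 2\<close> for all
    generations at once; \<open>C + 1\<close> keeps the denominator positive when
    \<open>C = 0\<close>.\<close>
  then obtain j0 where j0: "x ^ j0 < 1 / (2 * (C + 1))"
    using real_arch_pow_inv[of "1 / (2 * (C + 1))" x] C by auto
  have "C * x ^ Suc j0 \<le> (C + 1) * x ^ j0"
    using x C by (intro mult_mono power_decreasing) auto
  also have "\<dots> < 1 / 2"
    using j0 C by (simp add: field_simps)
  finally have half: "1 / 2 \<le> miss n (i, Suc j0)" for n
    using le[of j0 n] unfolding x_def[symmetric] by linarith
  let ?A = "\<lambda>n. {\<omega>. \<forall>k\<le>n. (0, 0) \<notin># gw (i, Suc j0) k \<omega>}"
  have "(\<lambda>n. prob (?A n)) \<longlonglongrightarrow> prob (\<Inter>n. ?A n)"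
  proof (rule finite_Lim_measure_decseq)
    have "?A n \<in> events" for n by (intro sets_gw_space_Collect) measurable
    then show "range ?A \<subseteq> events" by blast
  qed (auto simp: decseq_def)
  moreover have "prob (?A n) = miss n (i, Suc j0)" for n
    using emeasure_avoid_start[of off n "(0, 0)" "(i, Suc j0)"]
    by (simp add: avoid_eq_miss measure_def miss_nonneg)
  ultimately have "1 / 2 \<le> prob (\<Inter>n. ?A n)"
    using half by (intro LIMSEQ_le_const[of "\<lambda>n. prob (?A n)"]) auto
  also have "(\<Inter>n. ?A n) = {\<omega>. \<forall>n. (0, 0) \<notin># gw (i, Suc j0) n \<omega>}" by auto
  finally show ?thesis by (intro exI[of _ j0]) linarith
qed

text \<open>An individual on this line almost surely causes at least one later visit. Its
  descendants on the line exist in all later generations, and applying this to each of them gives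
  infinitely many visits.\<close>

lemma AE_critical_line_hits_origin:
  assumes "r \<le> 1" "p \<le> r ^ i" "r ^ Suc i \<le> p"
  shows "AE \<omega> in Om. \<forall>j n. (Suc i, j) \<in># gw x n \<omega> \<longrightarrow> visits x {(0, 0)} \<omega>"
proof -
  have "AE \<omega> in Om. \<forall>j k. (Suc i, Suc j) \<in># gw x k \<omega> \<longrightarrow> (\<exists>n\<ge>k. (0, 0) \<in># gw x n \<omega>)"
    using tendsto_ennrealI[OF miss_critical_line_tendsto_0[OF assms]]
    by (subst AE_all_countable) (simp add: AE_hits_if_avoid_tendsto_0 avoid_eq_miss)
  then show ?thesis
    using AE_in_support[of off]
  proof eventually_elim
    case (elim \<omega>)
    show ?case
    proof (intro allI impI)
      fix j n assume *: "(Suc i, j) \<in># gw x n \<omega>"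
      have "\<exists>n'\<ge>m. (0, 0) \<in># gw x n' \<omega>" for m
      proof -
        \<comment> \<open>Moving \<open>Suc m\<close> steps ensures a positive column, as required
          by the limit of \<open>miss\<close>.\<close>
        have "(Suc i, Suc (j + m)) \<in># gw x (n + Suc m) \<omega>"
          using gw_line_Suc[OF elim(2) *, of "Suc m"] by (simp del: gw.simps)
        then obtain n' where "n' \<ge> n + Suc m" "(0, 0) \<in># gw x n' \<omega>"
          using elim(1) by blast
        then show ?thesis by (intro exI[of _ n']) auto
      qed
      then show "visits x {(0, 0)} \<omega>"
        by (simp add: visits_def INFM_nat_le)
    qed
  qed
qed

subsection \<open>Survival events\<close>

text \<open>The number of individuals along the chain is at most its initial value \<open>C\<close>,
  so in every generation the chain breaks with probability at least \<open>(1 - q) ^ C\<close>.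
  Since the initial number is random, the Borel-Cantelli argument is made for all \<open>C\<close>
  first.\<close>

lemma AE_origin_chain_dies: "AE \<omega> in Om. \<forall>N k. \<exists>t. (k + t, 0) \<notin># gw x (N + t) \<omega>"
proof -
  define T where "T N k C n \<omega> \<longleftrightarrow> N \<le> n \<and> (k + (n - N), 0) \<in># gw x n \<omega> \<and>
    count (gw x n \<omega>) (k + (n - N), 0) \<le> C" for N k C n \<omega>
  define R where "R N k n \<omega> \<longleftrightarrow> (Suc (k + (n - N)), 0) \<notin># gw x (Suc n) \<omega>" for N k n \<omega>
  have only: "child off y (Suc l, 0) \<Longrightarrow> y = (l, 0)" for y l
    by (erule child_cases) auto
  have one: "M \<in> set_pmf (off (l, 0)) \<Longrightarrow> count M (Suc l, 0) \<le> 1" for M l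
    by (cases l) (auto split: if_splits)
  have prob_none: "measure_pmf.prob (off (l, 0)) {M. (Suc l, 0) \<notin># M} = 1 - q" for l
  proof -
    have "{b. \<not> b} = {False}" by auto
    then show ?thesis
      using q by (cases l) (auto simp: vimage_def measure_pmf_single)
  qed
  have prob_none': "measure_pmf.prob (off y) {M. (Suc l, 0) \<notin># M} = 1" if "y \<noteq> (l, 0)" for y l
    using only[of y l] that by (intro measure_pmf.prob_eq_1[THEN iffD2] AE_pmfI) (auto simp: child_def)
  have "AE \<omega> in Om. (\<exists>\<^sub>\<infinity>n. T N k C n \<omega>) \<longrightarrow> (\<exists>\<^sub>\<infinity>n. T N k C n \<omega> \<and> R N k n \<omega>)" for N k C
  proof (rule AE_trials_succeed_infinitely_often[where c = "(1 - q) ^ C" and x = x])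
    fix n E assume E: "adapted x n E" "\<And>\<omega>. E \<omega> \<Longrightarrow> T N k C n \<omega>"
    have [measurable]: "Measurable.pred Om E" using E(1) by (rule measurable_adapted)
    define l where "l = k + (n - N)"
    let ?z = "(Suc l, 0)"
    have "count (gw x n \<omega>) (l, 0) \<le> C" if "E \<omega>" for \<omega>
      using E(2)[OF that] unfolding T_def l_def by blast
    from measure_avoid_type_Suc_ge[where off = off and z = ?z, OF E(1) this prob_none']
    have "(1 - q) ^ C * prob {\<omega>. E \<omega>} \<le> prob {\<omega>. E \<omega> \<and> ?z \<notin># gw x (Suc n) \<omega>}"
      by (simp add: prob_none del: gw.simps)
    moreover have "prob {\<omega>. E \<omega> \<and> \<not> R N k n \<omega>} = prob ({\<omega>. E \<omega>} - {\<omega>. E \<omega> \<and> ?z \<notin># gw x (Suc n) \<omega>})"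
      by (intro arg_cong[where f = prob]) (auto simp: R_def l_def simp del: gw.simps)
    moreover have "\<dots> = prob {\<omega>. E \<omega>} - prob {\<omega>. E \<omega> \<and> ?z \<notin># gw x (Suc n) \<omega>}"
      by (intro finite_measure_Diff sets_gw_space_Collect) (measurable, auto)
    ultimately show "prob {\<omega>. E \<omega> \<and> \<not> R N k n \<omega>} \<le> (1 - (1 - q) ^ C) * prob {\<omega>. E \<omega>}"
      by (simp add: algebra_simps)
  qed (use q in \<open>auto simp: T_def R_def intro!: adapted_gw adapted_conj adapted_const simp del: gw.simps\<close>)
  then have "AE \<omega> in Om. \<forall>N k C. (\<exists>\<^sub>\<infinity>n. T N k C n \<omega>) \<longrightarrow> (\<exists>\<^sub>\<infinity>n. T N k C n \<omega> \<and> R N k n \<omega>)"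
    unfolding AE_all_countable by blast
  then show ?thesis
    using AE_in_support[of off]
  proof eventually_elim
    case (elim \<omega>)
    show ?case
    proof (intro allI)
      fix N k
      show "\<exists>t. (k + t, 0) \<notin># gw x (N + t) \<omega>"
      proof (rule ccontr)
        assume "\<nexists>t. (k + t, 0) \<notin># gw x (N + t) \<omega>"
        then have in': "(k + t, 0) \<in># gw x (N + t) \<omega>" for t by blast
        define C where "C = count (gw x N \<omega>) (k, 0)"
        have "count (gw x (N + t) \<omega>) (k + t, 0) \<le> C" for t
        proof (induction t)
          case (Suc t)
          have "count (gw x (Suc (N + t)) \<omega>) (Suc (k + t), 0) \<le> count (gw x (N + t) \<omega>) (k + t, 0)"
            by (rule count_gw_Suc_le[OF elim(2) only one])
          with Suc show ?case by (simp del: gw.simps)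
        qed (simp add: C_def)
        then have "T N k C (N + t) \<omega>" for t
          using in' by (simp add: T_def)
        then have "\<exists>\<^sub>\<infinity>n. T N k C n \<omega>"
          unfolding INFM_nat_le by (metis add.commute le_add1)
        with elim(1) have "\<exists>\<^sub>\<infinity>n. T N k C n \<omega> \<and> R N k n \<omega>"
          by blast
        then obtain n where "T N k C n \<omega>" "R N k n \<omega>"
          using INFM_EX by blast
        then show False
          using in'[of "Suc (n - N)"] by (simp add: T_def R_def Suc_diff_le del: gw.simps)
      qed
    qed
  qed
qed

text \<open>A line can be raised only through column 0. After the last visit to the origin at time
  \<open>N\<close>, every individual in column 0 on a line \<open>\<ge> 1\<close> traces back along
  a chain to some \<open>(k, 0)\<close> in generation \<open>N\<close>; there are finitely many such
  \<open>k\<close>, and each chain dies.\<close>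

lemma AE_lines_bounded:
  "AE \<omega> in Om. \<not> visits x {(0, 0)} \<omega> \<longrightarrow> (\<exists>N K. \<forall>n\<ge>N. \<forall>y\<in>#gw x n \<omega>. fst y < K)"
  using AE_origin_chain_dies[of x] AE_in_support[of off]
proof eventually_elim
  case (elim \<omega>)
  note parent = gw_Suc_parent[OF elim(2)]
  show ?case
  proof
    assume "\<not> visits x {(0, 0)} \<omega>"
    then obtain N where N: "\<And>n. N \<le> n \<Longrightarrow> (0, 0) \<notin># gw x n \<omega>"
      by (auto simp: visits_def INFM_nat_le)
    obtain \<tau> where \<tau>: "\<And>k. (k + \<tau> k, 0) \<notin># gw x (N + \<tau> k) \<omega>"
      using elim(1) by metis
    define K0 where "K0 = Max (insert 0 (fst ` set_mset (gw x N \<omega>)))"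
    have K0: "fst y \<le> K0" if "y \<in># gw x N \<omega>" for y
      unfolding K0_def using that by (intro Max_ge) auto
    define K where "K = Max (insert K0 ((\<lambda>k. k + \<tau> k) ` {..K0}))"
    have K0_le: "K0 \<le> K"
      unfolding K_def by (rule Max_ge) auto
    have K: "k + \<tau> k \<le> K" if "k \<le> K0" for k
      unfolding K_def using that by (intro Max_ge) auto
    have origin: "(k, 0) \<in># gw x N \<omega>" if "(k + t, 0) \<in># gw x (N + t) \<omega>" for k t
      using that
    proof (induction t)
      case (Suc t)
      then have "(Suc (k + t), 0) \<in># gw x (Suc (N + t)) \<omega>" by (simp del: gw.simps)
      then obtain y where y: "y \<in># gw x (N + t) \<omega>" "child off y (Suc (k + t), 0)"
        by (rule parent)
      from y(2) have "y = (k + t, 0)" by (rule child_cases) auto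
      with y Suc.IH show ?case by auto
    qed simp
    have fore: "(k + s, 0) \<in># gw x (N + s) \<omega>" if "(k + t, 0) \<in># gw x (N + t) \<omega>" "s \<le> t" for k s t
      using that
    proof (induction t)
      case (Suc t)
      show ?case
      proof (cases "s = Suc t")
        case False
        have "(Suc (k + t), 0) \<in># gw x (Suc (N + t)) \<omega>" using Suc.prems by (simp del: gw.simps)
        then obtain y where y: "y \<in># gw x (N + t) \<omega>" "child off y (Suc (k + t), 0)"
          by (rule parent)
        from y(2) have "y = (k + t, 0)" by (rule child_cases) auto
        with y Suc False show ?thesis by auto
      qed (use Suc in auto)
    qed simp
    \<comment> \<open>If \<open>t > l\<close>, tracing the chain back would reach the origin after
      time \<open>N\<close>. Hence \<open>l = k + t\<close>, and \<open>fore\<close> forces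
      \<open>t\<close> to precede the death time \<open>\<tau> k\<close>.\<close>
    have start: "l < K" if "(l, 0) \<in># gw x (N + t) \<omega>" "0 < t" for l t
    proof -
      have "t \<le> l"
        using that(1)
      proof (induction t arbitrary: l)
        case (Suc t)
        have "l \<noteq> 0" using Suc.prems N[of "N + Suc t"] by (intro notI) (simp del: gw.simps)
        then obtain l' where l: "l = Suc l'" by (cases l) auto
        have "(Suc l', 0) \<in># gw x (Suc (N + t)) \<omega>" using Suc.prems by (simp add: l del: gw.simps)
        then obtain y where y: "y \<in># gw x (N + t) \<omega>" "child off y (Suc l', 0)"
          by (rule parent)
        from y(2) have "y = (l', 0)" by (rule child_cases) auto
        with y Suc.IH l show ?case by auto
      qed simp
      then obtain k where k: "l = k + t" by (metis add.commute le_Suc_ex)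
      have "k \<le> K0" using origin[of k t] that K0 by (auto simp: k)
      moreover have "t < \<tau> k"
        using fore[of k t "\<tau> k"] that \<tau>[of k] by (force simp: k)
      ultimately show ?thesis using K[of k] by (auto simp: k)
    qed
    have "fst y < Suc K" if "y \<in># gw x (N + t) \<omega>" for t y
      using that
    proof (induction t arbitrary: y)
      case 0
      then show ?case using K0[of y] K0_le by auto
    next
      case (Suc t)
      then have "y \<in># gw x (Suc (N + t)) \<omega>" by (simp del: gw.simps)
      then obtain z where z: "z \<in># gw x (N + t) \<omega>" "child off z y"
        by (rule parent)
      have "fst y \<le> fst z \<or> snd y = 0"
        using z(2) by (rule child_cases) auto
      then show ?case
        using Suc.IH[OF z(1)] start[of "fst y" "Suc t"] Suc.prems by (cases y) auto
    qed
    then show "\<exists>N K. \<forall>n\<ge>N. \<forall>y\<in>#gw x n \<omega>. fst y < K"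
      by (metis le_Suc_ex)
  qed
qed

text \<open>The inequality is strict: line \<open>i\<close> itself is forbidden too, in every
  generation including the initial one.\<close>

definition never_above :: "nat \<Rightarrow> nat \<times> nat \<Rightarrow> (nat \<times> (nat \<times> nat) \<times> nat \<Rightarrow> (nat \<times> nat) multiset) \<Rightarrow> bool" where
  "never_above i x \<omega> \<longleftrightarrow> (\<forall>n. \<forall>y\<in>#gw x n \<omega>. fst y < i)"

lemma pred_never_above [measurable]: "Measurable.pred Om (never_above i x)"
  unfolding never_above_def Ball_def by measurable

lemma infinite_line: "infinite (line i)"
proof -
  have "line i = range (Pair i)" by (auto simp: line_def)
  then show ?thesis by (simp add: finite_image_iff inj_on_def)
qed

lemma never_above_imp_not_visits_origin:
  assumes "\<forall>y z. visits x {y} \<omega> \<longrightarrow> visits x {z} \<omega>" "never_above i x \<omega>"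
  shows "\<not> visits x {(0, 0)} \<omega>"
proof
  assume "visits x {(0, 0)} \<omega>"
  with assms(1) have "visits x {(i, 0)} \<omega>" by blast
  with assms(2) show False by (force simp: visits_def never_above_def INFM_nat_le)
qed

lemma AE_descend:
  assumes "r \<le> 1"
  shows "AE \<omega> in Om. \<forall>k j n i. (k, j) \<in># gw x n \<omega> \<longrightarrow> i \<le> k \<longrightarrow> (\<exists>n j. (i, j) \<in># gw x n \<omega>)"
proof -
  have "AE \<omega> in Om. \<forall>k j n. (Suc k, j) \<in># gw x n \<omega> \<longrightarrow> visits x (line k \<inter> UNIV) \<omega>"
    using AE_line_feeds_lower_line[OF assms, of _ UNIV x] infinite_line
    by (subst AE_all_countable) auto
  then show ?thesis
  proof eventually_elim
    case (elim \<omega>)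
    have "\<exists>n j. (i, j) \<in># gw x n \<omega>" if "(k, j) \<in># gw x n \<omega>" "i \<le> k" for k j n i
      using that
    proof (induction k arbitrary: j n)
      case (Suc k)
      show ?case
      proof (cases "i = Suc k")
        case False
        from elim Suc.prems have "visits x (line k \<inter> UNIV) \<omega>" by blast
        then obtain n' j' where "(k, j') \<in># gw x n' \<omega>"
          by (auto simp: visits_def INFM_nat_le line_def)
        then show ?thesis using Suc False by auto
      qed (use Suc in auto)
    qed auto
    then show ?case by blast
  qed
qed

text \<open>The descendants on the line pass through every later column, hence through infinitely
  many points of \<open>A\<close>.\<close>

lemma line_reached_imp_visits:
  assumes "in_support off \<omega>" "(Suc i, j) \<in># gw x n \<omega>" "infinite (line (Suc i) \<inter> A)"
  shows "visits x A \<omega>"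
  unfolding visits_def INFM_nat_le
proof
  fix m
  have "\<not> line (Suc i) \<inter> A \<subseteq> Pair (Suc i) ` {..<j + m}"
    using assms(3) by (meson finite_imageI finite_lessThan finite_subset)
  then obtain y where y: "y \<in> line (Suc i)" "y \<in> A" "y \<notin> Pair (Suc i) ` {..<j + m}"
    by blast
  then obtain j' where "y = (Suc i, j')" by (auto simp: line_def)
  with y have j': "(Suc i, j') \<in> A" "j + m \<le> j'" by auto
  have "(Suc i, j') \<in># gw x (n + (j' - j)) \<omega>"
    using gw_line_Suc[OF assms(1,2), of "j' - j"] j' by simp
  moreover have "m \<le> n + (j' - j)" using j' by linarith
  ultimately show "\<exists>n\<ge>m. \<exists>y\<in>A. y \<in># gw x n \<omega>"
    using j' by blast
qed

lemma never_above_1_imp_bounded: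
  assumes "in_support off \<omega>" "never_above 1 x \<omega>" "y \<in># gw x n \<omega>"
  shows "snd y \<le> snd x"
  using assms(3)
proof (induction n arbitrary: y)
  case (Suc n)
  obtain z where z: "z \<in># gw x n \<omega>" "child off z y"
    using gw_Suc_parent[OF assms(1) Suc.prems] .
  have "fst z < 1" "fst y < 1" using assms(2) z(1) Suc.prems unfolding never_above_def by blast+
  with z(2) have "snd y \<le> snd z" by (cases rule: child_cases) auto
  with Suc.IH[OF z(1)] show ?case by simp
qed simp

lemma AE_visits_iff_never_above:
  assumes "r \<le> 1" "infinite (line i \<inter> A)" "\<And>l. l < i \<Longrightarrow> finite (line l \<inter> A)"
  shows "AE \<omega> in Om. visits x A \<omega> \<longleftrightarrow> \<not> never_above (max 1 i) x \<omega>"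
  using AE_visits_all[of x] AE_in_support[of off] AE_descend[OF assms(1), of x]
    AE_line_feeds_lower_line[OF assms(1,2), of x]
proof eventually_elim
  case (elim \<omega>)
  show ?case
  proof
    assume A: "visits x A \<omega>"
    show "\<not> never_above (max 1 i) x \<omega>"
    proof
      assume na: "never_above (max 1 i) x \<omega>"
      then have no: "\<not> visits x {y} \<omega>" for y
        using never_above_imp_not_visits_origin elim(1) by blast
      define F where "F = (if i = 0 then {0} \<times> {..snd x} else (\<Union>l<i. line l \<inter> A))"
      have "finite (\<Union>l<i. line l \<inter> A)"
        by (rule finite_UN_I) (use assms(3) in auto)
      then have "finite F" unfolding F_def by auto
      have "y \<in> F" if y: "y \<in> A" "y \<in># gw x n \<omega>" for n y
      proof (cases "i = 0")
        case True
        with na y have "fst y = 0" by (force simp: never_above_def)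
        moreover have "snd y \<le> snd x"
          using na True by (intro never_above_1_imp_bounded[OF elim(2) _ y(2)]) simp
        ultimately show ?thesis by (cases y) (auto simp: F_def True)
      next
        case False
        with na y have "fst y < i" by (force simp: never_above_def max_def)
        then show ?thesis using y(1) False by (cases y) (auto simp: F_def line_def)
      qed
      with A have "visits x F \<omega>"
        unfolding visits_def by (elim INFM_mono) blast
      with no visits_finite_iff[OF \<open>finite F\<close>] show False by blast
    qed
  next
    assume "\<not> never_above (max 1 i) x \<omega>"
    then obtain n y where "y \<in># gw x n \<omega>" "\<not> fst y < max 1 i"
      unfolding never_above_def by blast
    then have "(fst y, snd y) \<in># gw x n \<omega>" "max 1 i \<le> fst y" by auto
    with elim(3) obtain n j where nj: "(max 1 i, j) \<in># gw x n \<omega>"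
      by blast
    show "visits x A \<omega>"
    proof (cases i)
      case 0
      with nj elim(4) have "visits x (line 0 \<inter> A) \<omega>" by auto
      then show ?thesis by (rule visits_mono) simp
    next
      case (Suc i')
      with nj assms(2) elim(2) show ?thesis by (intro line_reached_imp_visits[of \<omega> i' j x n]) auto
    qed
  qed
qed

text \<open>Without recurrence of the origin only finitely many lines are eventually occupied, and
  their part of \<open>A\<close> is finite; a finite set visited infinitely often contains a type
  visited infinitely often.\<close>

lemma AE_visits_origin_iff:
  assumes "A \<noteq> {}" "\<And>l. finite (line l \<inter> A)"
  shows "AE \<omega> in Om. visits x A \<omega> \<longleftrightarrow> visits x {(0, 0)} \<omega>"
  using AE_visits_all[of x] AE_lines_bounded[of x]
proof eventually_elim
  case (elim \<omega>)
  show ?case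
  proof
    assume A: "visits x A \<omega>"
    show "visits x {(0, 0)} \<omega>"
    proof (rule ccontr)
      assume no: "\<not> visits x {(0, 0)} \<omega>"
      with elim(2) obtain N K where NK: "\<forall>n\<ge>N. \<forall>y\<in>#gw x n \<omega>. fst y < K" by blast
      define F where "F = (\<Union>l<K. line l \<inter> A)"
      have "y \<in> F" if "N \<le> n" "y \<in> A" "y \<in># gw x n \<omega>" for n y
        using that NK by (cases y) (force simp: F_def line_def)
      with A have "visits x F \<omega>"
        unfolding visits_def INFM_nat_le by (meson max.boundedE max.cobounded1)
      moreover have "finite F" unfolding F_def by (rule finite_UN_I) (use assms(2) in auto)
      ultimately show False using no elim(1) visits_finite_iff by blast
    qed
  next
    assume "visits x {(0, 0)} \<omega>"
    obtain y where "y \<in> A" using assms(1) by blast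
    have "visits x {y} \<omega>" using elim(1) \<open>visits x {(0, 0)} \<omega>\<close> by blast
    then show "visits x A \<omega>" by (rule visits_mono) (use \<open>y \<in> A\<close> in simp)
  qed
qed

text \<open>Every line from \<open>i\<close> on leads down to the lowest line \<open>i0\<close> with
  \<open>r ^ i0 \<le> p\<close>, which hits the origin infinitely often. Here \<open>i0\<close> is
  positive as \<open>p < 1\<close>, and its predecessor satisfies the other inequality of the
  critical case.\<close>

lemma AE_never_above_iff:
  assumes "r \<le> 1" "r ^ i \<le> p"
  shows "AE \<omega> in Om. never_above i x \<omega> \<longleftrightarrow> \<not> visits x {(0, 0)} \<omega>"
proof -
  define i0 where "i0 = (LEAST i. r ^ i \<le> p)"
  have i0: "r ^ i0 \<le> p" "i0 \<le> i"
    unfolding i0_def using assms(2) by (auto intro: LeastI Least_le)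
  then have "i0 \<noteq> 0" using p by (intro notI) simp
  then obtain i' where i': "i0 = Suc i'" by (cases i0) auto
  have "\<not> r ^ i' \<le> p" unfolding i0_def using not_less_Least[of i' "\<lambda>i. r ^ i \<le> p"] i' i0_def by simp
  then have crit: "AE \<omega> in Om. \<forall>j n. (i0, j) \<in># gw x n \<omega> \<longrightarrow> visits x {(0, 0)} \<omega>"
    unfolding i' using assms(1) i0 i' by (intro AE_critical_line_hits_origin) auto
  show ?thesis
    using AE_visits_all[of x] AE_descend[OF assms(1), of x] crit
  proof eventually_elim
    case (elim \<omega>)
    show ?case
    proof
      assume "\<not> visits x {(0, 0)} \<omega>"
      with elim i0 show "never_above i x \<omega>"
        unfolding never_above_def by (metis linorder_not_less order_trans prod.collapse)
    qed (use elim never_above_imp_not_visits_origin in blast)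
  qed
qed

subsection \<open>Extinction probability vectors\<close>

definition Q :: "nat \<Rightarrow> nat \<times> nat \<Rightarrow> real" where
  "Q i x = prob {\<omega>. never_above i x \<omega>}"

definition Qtilde :: "nat \<times> nat \<Rightarrow> real" where
  "Qtilde x = prob {\<omega>. \<not> visits x {(0, 0)} \<omega>}"

lemma ext_prob_eq: "ext_prob off A x = prob {\<omega>. \<not> visits x A \<omega>}"
  by (simp add: ext_prob_def extinct_in_iff)

lemma prob_cong_AE:
  assumes "AE \<omega> in Om. P \<omega> \<longleftrightarrow> P' \<omega>" "Measurable.pred Om P" "Measurable.pred Om P'"
  shows "prob {\<omega>. P \<omega>} = prob {\<omega>. P' \<omega>}"
  using assms by (intro finite_measure_eq_AE sets_gw_space_Collect) auto

lemma partial_ext_prob_eq: "partial_ext_prob off = Qtilde"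
proof
  fix x :: "nat \<times> nat"
  have "(\<forall>A. finite A \<longrightarrow> extinct_in x A \<omega>) \<longleftrightarrow> (\<forall>y. \<not> visits x {y} \<omega>)" for \<omega>
    unfolding extinct_in_iff using visits_finite_iff by (metis finite.emptyI finite_insert)
  then have "partial_ext_prob off x = prob {\<omega>. \<forall>y. \<not> visits x {y} \<omega>}"
    by (simp add: partial_ext_prob_def)
  also have "\<dots> = Qtilde x"
    unfolding Qtilde_def
  proof (rule prob_cong_AE)
    show "AE \<omega> in Om. (\<forall>y. \<not> visits x {y} \<omega>) \<longleftrightarrow> \<not> visits x {(0, 0)} \<omega>"
      using AE_visits_all[of x] by eventually_elim blast
  qed measurable
  finally show "partial_ext_prob off x = Qtilde x" .
qed

lemma ext_prob_eq_Q:
  assumes "r \<le> 1" "iota A = enat i"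
  shows "ext_prob off A = Q (max 1 i)"
proof
  fix x
  show "ext_prob off A x = Q (max 1 i) x"
    unfolding ext_prob_eq Q_def
  proof (rule prob_cong_AE)
    show "AE \<omega> in Om. (\<not> visits x A \<omega>) \<longleftrightarrow> never_above (max 1 i) x \<omega>"
    proof -
      have "AE \<omega> in Om. visits x A \<omega> \<longleftrightarrow> \<not> never_above (max 1 i) x \<omega>"
        using AE_visits_iff_never_above[OF assms(1)] iota_eq_enatD[OF assms(2)] by blast
      then show ?thesis by eventually_elim blast
    qed
  qed measurable
qed

lemma ext_prob_eq_Qtilde:
  assumes "A \<noteq> {}" "iota A = \<infinity>"
  shows "ext_prob off A = Qtilde"
proof
  fix x
  show "ext_prob off A x = Qtilde x"
    unfolding ext_prob_eq Qtilde_def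
  proof (rule prob_cong_AE)
    show "AE \<omega> in Om. (\<not> visits x A \<omega>) \<longleftrightarrow> \<not> visits x {(0, 0)} \<omega>"
      using AE_visits_origin_iff[OF assms(1) iota_eq_infinityD[OF assms(2)], of x] by eventually_elim blast
  qed measurable
qed

lemma Q_eq_Qtilde:
  assumes "r \<le> 1" "r ^ i \<le> p"
  shows "Q i = Qtilde"
proof
  fix x
  show "Q i x = Qtilde x"
    unfolding Q_def Qtilde_def by (rule prob_cong_AE[OF AE_never_above_iff[OF assms]]) measurable
qed

lemma Q_le_Qtilde: "Q i \<le> Qtilde"
proof (rule le_funI)
  fix x
  show "Q i x \<le> Qtilde x"
    unfolding Q_def Qtilde_def
  proof (rule finite_measure_mono_AE)
    show "AE \<omega> in Om. \<omega> \<in> {\<omega>. never_above i x \<omega>} \<longrightarrow> \<omega> \<in> {\<omega>. \<not> visits x {(0, 0)} \<omega>}"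
      using AE_visits_all[of x] by eventually_elim (use never_above_imp_not_visits_origin in blast)
    show "{\<omega>. \<not> visits x {(0, 0)} \<omega>} \<in> events"
      by (rule sets_gw_space_Collect) measurable
  qed
qed

lemma Q_mono: "i \<le> j \<Longrightarrow> Q i \<le> Q j"
  unfolding Q_def
  by (intro le_funI finite_measure_mono sets_gw_space_Collect pred_never_above)
     (force simp: never_above_def)

text \<open>The vectors differ at a type \<open>(i, Suc j)\<close> far to the right: line
  \<open>i\<close> is occupied at once, so \<open>Q i\<close> vanishes there, yet with positive
  probability the origin is missed and line \<open>i + 1\<close> is never reached.\<close>

lemma Q_strict:
  assumes "r \<le> 1" "p < r ^ i" "1 \<le> i"
  shows "Q i < Q (Suc i)"
proof -
  obtain j where pos: "0 < prob {\<omega>. \<forall>n. (0, 0) \<notin># gw (i, Suc j) n \<omega>}"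
    using prob_never_origin_positive[OF assms(1,2)] by blast
  let ?x = "(i, Suc j)"
  have "AE \<omega> in Om. \<omega> \<in> {\<omega>. \<forall>n. (0, 0) \<notin># gw ?x n \<omega>} \<longrightarrow> \<omega> \<in> {\<omega>. never_above (Suc i) ?x \<omega>}"
    using AE_in_support[of off]
  proof eventually_elim
    case (elim \<omega>)
    show ?case
    proof
      assume "\<omega> \<in> {\<omega>. \<forall>n. (0, 0) \<notin># gw ?x n \<omega>}"
      then have no: "(0, 0) \<notin># gw ?x n \<omega>" for n by blast
      have "fst y \<le> i \<and> (fst y = 0 \<or> snd y \<noteq> 0)" if "y \<in># gw ?x n \<omega>" for n y
        using that
      proof (induction n arbitrary: y)
        case (Suc n)
        obtain z where z: "z \<in># gw ?x n \<omega>" "child off z y"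
          using gw_Suc_parent[OF elim Suc.prems] .
        have "z \<noteq> (0, 0)" using z(1) no by auto
        with z(2) Suc.IH[OF z(1)] show ?case by (cases rule: child_cases) auto
      qed simp
      then show "\<omega> \<in> {\<omega>. never_above (Suc i) ?x \<omega>}"
        by (auto simp: never_above_def less_Suc_eq_le)
    qed
  qed
  then have "prob {\<omega>. \<forall>n. (0, 0) \<notin># gw ?x n \<omega>} \<le> Q (Suc i) ?x"
    unfolding Q_def by (rule finite_measure_mono_AE) (rule sets_gw_space_Collect, measurable)
  moreover have "Q i ?x = 0"
  proof -
    have "\<not> never_above i ?x \<omega>" for \<omega>
      unfolding never_above_def by (auto intro!: exI[of _ 0])
    then show ?thesis by (simp add: Q_def)
  qed
  ultimately have "\<not> Q (Suc i) ?x \<le> Q i ?x" using pos by linarith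
  then have "\<not> Q (Suc i) \<le> Q i" by (metis le_funD)
  with Q_mono[of i "Suc i"] show ?thesis by (simp add: less_le_not_le)
qed

lemma ext_vectors_eq:
  assumes "r \<le> 1"
  shows "ext_vectors off = insert Qtilde (Q ` {1..})"
proof
  show "ext_vectors off \<subseteq> insert Qtilde (Q ` {1..})"
  proof
    fix v assume "v \<in> ext_vectors off"
    then obtain A where A: "A \<noteq> {}" "v = ext_prob off A" by (auto simp: ext_vectors_def)
    show "v \<in> insert Qtilde (Q ` {1..})"
      using ext_prob_eq_Q[OF assms, of A] ext_prob_eq_Qtilde[OF A(1)] A(2) by (cases "iota A") auto
  qed
  have "line i \<noteq> {}" for i by (auto simp: line_def)
  moreover have "ext_prob off (line i) = Q i" if "1 \<le> i" for i
    using ext_prob_eq_Q[OF assms iota_line, of i] that by (simp add: max_def)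
  ultimately have "Q i \<in> ext_vectors off" if "1 \<le> i" for i
    unfolding ext_vectors_def using that by (metis (mono_tags, lifting) mem_Collect_eq)
  then have "Q ` {1..} \<subseteq> ext_vectors off" by auto
  moreover have "Qtilde \<in> ext_vectors off"
  proof -
    have "{enat i | i. infinite (line i \<inter> {(0, 0)})} = {}" by auto
    then have "iota {(0, 0)} = \<infinity>" unfolding iota_def by (simp add: top_enat_def)
    then have "ext_prob off {(0, 0)} = Qtilde" by (intro ext_prob_eq_Qtilde) auto
    then show ?thesis
      unfolding ext_vectors_def by (metis (mono_tags, lifting) insert_not_empty mem_Collect_eq)
  qed
  ultimately show "insert Qtilde (Q ` {1..}) \<subseteq> ext_vectors off" by simp
qed

section \<open>Uncountably many vectors for \<open>r > 1\<close>\<close>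

lemma prob_single_line_positive:
  assumes "1 < r"
  shows "\<exists>j. 0 < prob {\<omega>. \<forall>n. gw (Suc k, Suc j) n \<omega> = {#(Suc k, Suc (j + n))#}}"
proof -
  define e where "e = 1 / r"
  have e: "0 < e" "e < 1" using assms by (auto simp: e_def)
  \<comment> \<open>A lower child at step \<open>n\<close> has probability at most
    \<open>e ^ (j + n)\<close>. This choice of \<open>j\<close> makes the sum over \<open>n\<close>
    less than 1, so with positive probability the process is a single individual moving right
    forever.\<close>
  obtain j where j: "e ^ j < 1 - e"
    using real_arch_pow_inv[of "1 - e" e] e by auto
  define B where "B n = {\<omega> :: nat \<times> (nat \<times> nat) \<times> nat \<Rightarrow> (nat \<times> nat) multiset.
    \<omega> (n, (Suc k, Suc (j + n)), 0) \<in> {M. (k, Suc (j + n)) \<in># M}}" for n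
  have B: "B n \<in> events" for n
    unfolding B_def by (rule measure_litter)
  have B_le: "prob (B n) \<le> e ^ j * e ^ n" for n
  proof -
    have "prob (B n) = r powi - int (j + n) / (1 + r powi - int (j + n))"
      unfolding B_def measure_litter prob_child_down ..
    also have "\<dots> \<le> r powi - int (j + n) / 1"
      using mean_pos[of "- int (j + n)"] by (intro divide_left_mono) auto
    also have "\<dots> = e ^ j * e ^ n"
      unfolding power_int_minus power_int_of_nat
      by (simp add: e_def power_one_over inverse_eq_divide power_add field_simps)
    finally show ?thesis .
  qed
  have geo: "(\<lambda>n. e ^ j * e ^ n) sums (e ^ j * (1 / (1 - e)))"
    using e by (intro sums_mult geometric_sums) auto
  have summ: "summable (\<lambda>n. prob (B n))"
    by (rule summable_comparison_test'[OF sums_summable[OF geo], of 0]) (use B_le in auto)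
  have "prob (\<Union>n. B n) \<le> (\<Sum>n. prob (B n))"
    using B summ by (intro finite_measure_subadditive_countably) auto
  also have "\<dots> \<le> e ^ j * (1 / (1 - e))"
    using suminf_le[OF B_le summ sums_summable[OF geo]] sums_unique[OF geo] by simp
  also have "\<dots> < 1" using j e by (simp add: field_simps)
  finally have "0 < 1 - prob (\<Union>n. B n)" by simp
  also have "\<dots> = prob (UNIV - (\<Union>n. B n))"
    using prob_compl[of "\<Union>n. B n"] B by auto
  also have "\<dots> \<le> prob {\<omega>. \<forall>n. gw (Suc k, Suc j) n \<omega> = {#(Suc k, Suc (j + n))#}}"
  proof (rule finite_measure_mono_AE)
    show "AE \<omega> in Om. \<omega> \<in> UNIV - (\<Union>n. B n) \<longrightarrow>
      \<omega> \<in> {\<omega>. \<forall>n. gw (Suc k, Suc j) n \<omega> = {#(Suc k, Suc (j + n))#}}"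
      using AE_in_support[of off]
    proof eventually_elim
      case (elim \<omega>)
      show ?case
      proof
        assume nB: "\<omega> \<in> UNIV - (\<Union>n. B n)"
        have "gw (Suc k, Suc j) n \<omega> = {#(Suc k, Suc (j + n))#}" for n
        proof (induction n)
          case (Suc n)
          have "\<omega> (n, (Suc k, Suc (j + n)), 0) \<in> set_pmf (off (Suc k, Suc (j + n)))"
            using elim unfolding in_support_def by blast
          then obtain t where "\<omega> (n, (Suc k, Suc (j + n)), 0) =
              replicate_mset t (k, Suc (j + n)) + {#(Suc k, Suc (j + n) + 1)#}"
            by auto
          moreover have "(k, Suc (j + n)) \<notin># \<omega> (n, (Suc k, Suc (j + n)), 0)"
            using nB by (auto simp: B_def)
          ultimately have "\<omega> (n, (Suc k, Suc (j + n)), 0) = {#(Suc k, Suc (j + Suc n))#}"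
            by (cases t) auto
          with Suc show ?case by simp
        qed simp
        then show "\<omega> \<in> {\<omega>. \<forall>n. gw (Suc k, Suc j) n \<omega> = {#(Suc k, Suc (j + n))#}}" by blast
      qed
    qed
    show "{\<omega>. \<forall>n. gw (Suc k, Suc j) n \<omega> = {#(Suc k, Suc (j + n))#}} \<in> events"
      by (rule sets_gw_space_Collect) measurable
  qed
  finally show ?thesis by blast
qed

text \<open>For \<open>k\<close> in \<open>I\<close> but not in \<open>J\<close>, start on line
  \<open>Suc k\<close>: its rightward descendants almost surely keep visiting the union for
  \<open>I\<close>, while with positive probability nothing else is born and the union for
  \<open>J\<close> is never met.\<close>

lemma ext_prob_lines_inj:
  assumes "1 < r"
  shows "inj (\<lambda>I. ext_prob off (\<Union>k\<in>I. line (Suc k)))"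
proof -
  have neq: "ext_prob off (\<Union>k\<in>I. line (Suc k)) \<noteq> ext_prob off (\<Union>k\<in>J. line (Suc k))"
    if k: "k \<in> I" "k \<notin> J" for k I J
  proof -
    obtain j where pos: "0 < prob {\<omega>. \<forall>n. gw (Suc k, Suc j) n \<omega> = {#(Suc k, Suc (j + n))#}}"
      using prob_single_line_positive[OF assms] by blast
    let ?x = "(Suc k, Suc j)"
    have "AE \<omega> in Om. \<not> \<not> visits ?x (\<Union>k\<in>I. line (Suc k)) \<omega>"
      using AE_in_support[of off]
    proof eventually_elim
      case (elim \<omega>)
      have "visits ?x (line (Suc k)) \<omega>"
        by (rule line_reached_imp_visits[OF elim, of k "Suc j" ?x 0]) (auto simp: infinite_line)
      then have "visits ?x (\<Union>k\<in>I. line (Suc k)) \<omega>"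
        by (rule visits_mono) (use k in blast)
      then show ?case by blast
    qed
    then have "ext_prob off (\<Union>k\<in>I. line (Suc k)) ?x = 0"
      unfolding ext_prob_eq by (subst prob_eq_0) (auto intro!: sets_gw_space_Collect)
    moreover have "0 < ext_prob off (\<Union>k\<in>J. line (Suc k)) ?x"
    proof -
      have "\<not> visits ?x (\<Union>k\<in>J. line (Suc k)) \<omega>"
        if "\<forall>n. gw ?x n \<omega> = {#(Suc k, Suc (j + n))#}" for \<omega>
        using that k(2) by (auto simp: visits_def line_def simp del: gw.simps)
      then have "prob {\<omega>. \<forall>n. gw ?x n \<omega> = {#(Suc k, Suc (j + n))#}} \<le>
          ext_prob off (\<Union>k\<in>J. line (Suc k)) ?x"
        unfolding ext_prob_eq
        by (intro finite_measure_mono) (auto intro!: sets_gw_space_Collect)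
      with pos show ?thesis by linarith
    qed
    ultimately show ?thesis by (metis less_irrefl)
  qed
  show ?thesis
  proof (rule injI, rule ccontr)
    fix I J :: "nat set"
    assume eq: "ext_prob off (\<Union>k\<in>I. line (Suc k)) = ext_prob off (\<Union>k\<in>J. line (Suc k))" and "I \<noteq> J"
    then obtain k where "k \<in> I \<and> k \<notin> J \<or> k \<in> J \<and> k \<notin> I" by blast
    then show False using neq eq by metis
  qed
qed

lemma uncountable_ext_vectors:
  assumes "1 < r"
  shows "uncountable (ext_vectors off)"
proof
  assume "countable (ext_vectors off)"
  let ?f = "\<lambda>I. ext_prob off (\<Union>k\<in>I. line (Suc k))"
  \<comment> \<open>The empty index set gives the empty set of types, which
    \<open>ext_vectors\<close> excludes.\<close>
  have "?f ` (UNIV - {{}}) \<subseteq> ext_vectors off"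
  proof
    fix v assume "v \<in> ?f ` (UNIV - {{}})"
    then obtain I where "I \<noteq> {}" "v = ?f I" by blast
    moreover from this have "(\<Union>k\<in>I. line (Suc k)) \<noteq> {}" by (auto simp: line_def)
    ultimately show "v \<in> ext_vectors off" unfolding ext_vectors_def by blast
  qed
  then have "countable (?f ` (UNIV - {{}}))"
    using \<open>countable (ext_vectors off)\<close> countable_subset by blast
  then have "countable (UNIV - {{} :: nat set})"
    by (rule countable_image_inj_on) (rule inj_on_subset[OF ext_prob_lines_inj[OF assms]], simp)
  then have "countable (UNIV :: nat set set)"
    using countable_insert[of "UNIV - {{}}" "{}"] by (simp add: insert_UNIV)
  then obtain g :: "nat set \<Rightarrow> nat" where "inj g"
    unfolding countable_def by blast
  then have "surj (inv g)" by (rule inj_imp_surj_inv)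
  then show False using Cantors_theorem[of UNIV] by auto
qed

end

section \<open>The three regimes of \<open>r\<close>\<close>

theorem proposition4:
  fixes p q r :: real
    and off :: "nat \<times> nat \<Rightarrow> (nat \<times> nat) multiset pmf"
    and ext :: "(nat \<times> nat) set \<Rightarrow> nat \<times> nat \<Rightarrow> real"
    and qtilde :: "nat \<times> nat \<Rightarrow> real"
    and istar :: nat
  assumes "0 < p" "p < 1" "0 < q" "q < 1" "0 < r"
  defines "off \<equiv> offspring p q r"
  defines "ext \<equiv> ext_prob off"
  defines "qtilde \<equiv> partial_ext_prob off"
  defines "istar \<equiv> LEAST i. 1 \<le> i \<and> r ^ i \<le> p"
  shows
    "(r < 1 \<longrightarrow>
        1 \<le> istar \<and> r ^ istar \<le> p \<and>
        finite (ext_vectors off) \<and> card (ext_vectors off) = istar \<and>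
        (istar = 1 \<longrightarrow> ext UNIV = qtilde \<and> ext_vectors off = {qtilde}) \<and>
        (istar \<ge> 2 \<longrightarrow>
           ext UNIV = ext (line 1) \<and>
           (\<forall>i. 1 \<le> i \<and> i < istar \<longrightarrow> ext (line i) < ext (line (Suc i))) \<and>
           ext (line istar) = qtilde \<and>
           ext_vectors off = (\<lambda>i. ext (line i)) ` {1..istar}) \<and>
        (\<forall>A i. iota A = enat i \<and> i < istar \<longrightarrow> ext A = ext (line i)) \<and>
        (\<forall>A. A \<noteq> {} \<and> enat istar \<le> iota A \<longrightarrow> ext A = qtilde))
     \<and>
     (r = 1 \<longrightarrow>
        infinite (ext_vectors off) \<and> countable (ext_vectors off) \<and>
        ext UNIV = ext (line 1) \<and>
        (\<forall>i\<ge>1. ext (line i) < ext (line (Suc i))) \<and>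
        (\<forall>i\<ge>1. ext (line i) \<noteq> qtilde) \<and>
        ext_vectors off = insert qtilde ((\<lambda>i. ext (line i)) ` {1..}) \<and>
        (\<forall>A i. iota A = enat i \<longrightarrow> ext A = ext (line i)) \<and>
        (\<forall>A. A \<noteq> {} \<and> iota A = \<infinity> \<longrightarrow> ext A = qtilde))
     \<and>
     (r > 1 \<longrightarrow> uncountable (ext_vectors off))"
proof -
  interpret P: grid_process p q r
    using assms(1-5) by unfold_locales
  have qt: "qtilde = P.Qtilde"
    by (simp add: qtilde_def off_def P.partial_ext_prob_eq)
  have iotaE: "ext A = P.Q (max 1 i)" if "r \<le> 1" "iota A = enat i" for A i
    unfolding ext_def off_def by (rule P.ext_prob_eq_Q[OF that])
  have line: "ext (line i) = P.Q (max 1 i)" if "r \<le> 1" for i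
    using iotaE[OF that iota_line] .
  have iota_inf: "ext A = qtilde" if "A \<noteq> {}" "iota A = \<infinity>" for A
    unfolding ext_def off_def qt by (rule P.ext_prob_eq_Qtilde[OF that])
  have univ: "ext UNIV = P.Q 1" if "r \<le> 1"
  proof -
    have "enat 0 \<in> {enat i | i. infinite (line i \<inter> UNIV)}"
      using P.infinite_line[of 0] by auto
    then have "iota UNIV \<le> enat 0" unfolding iota_def by (rule Inf_lower)
    then have "iota UNIV = enat 0" by (simp add: zero_enat_def[symmetric])
    from iotaE[OF that this] show ?thesis by simp
  qed
  have vectors: "ext_vectors off = insert P.Qtilde (P.Q ` {1..})" if "r \<le> 1"
    unfolding off_def by (rule P.ext_vectors_eq[OF that])
  show ?thesis
  proof (intro conjI impI)
    assume r1: "r < 1"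
    then have r: "r \<le> 1" by simp
    obtain n where "r ^ n < p" using real_arch_pow_inv[of p r] assms r1 by auto
    then have "1 \<le> n \<and> r ^ n \<le> p" using assms(2) by (cases n) auto
    then have istar: "1 \<le> istar \<and> r ^ istar \<le> p"
      unfolding istar_def by (rule LeastI)
    have below: "p < r ^ i" if "1 \<le> i" "i < istar" for i
      using not_less_Least[of i "\<lambda>i. 1 \<le> i \<and> r ^ i \<le> p"] that by (auto simp: istar_def not_le)
    \<comment> \<open>From \<open>istar\<close> on all vectors coincide, which cuts the family down
      to \<open>{1..istar}\<close>.\<close>
    have Qge: "P.Q i = P.Qtilde" if "istar \<le> i" for i
    proof (rule P.Q_eq_Qtilde[OF r])
      have "r ^ i \<le> r ^ istar" using that r assms(5) by (intro power_decreasing) auto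
      then show "r ^ i \<le> p" using istar by linarith
    qed
    have step: "P.Q i < P.Q (Suc i)" if "1 \<le> i" "i < istar" for i
      using P.Q_strict[OF r below[OF that] that(1)] .
    have vec: "ext_vectors off = P.Q ` {1..istar}"
    proof -
      have "P.Q i \<in> P.Q ` {1..istar}" if "1 \<le> i" for i
      proof (cases "i \<le> istar")
        case False
        then have "P.Q i = P.Q istar" using Qge[of i] Qge[of istar] by simp
        then show ?thesis using istar by auto
      qed (use that in auto)
      moreover have "P.Qtilde \<in> P.Q ` {1..istar}"
        using Qge[of istar] istar by (metis atLeastAtMost_iff image_eqI order_refl)
      ultimately show ?thesis
        unfolding vectors[OF r] by (intro equalityI subsetI) auto
    qed
    have mono: "P.Q i < P.Q j" if "1 \<le> i" "i < j" "j \<le> istar" for i j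
      using that(2,3)
    proof (induction j)
      case (Suc j)
      show ?case
      proof (cases "i = j")
        case False
        then have "P.Q i < P.Q j" using Suc by auto
        also have "\<dots> < P.Q (Suc j)" using Suc.prems that(1) by (intro step) auto
        finally show ?thesis .
      qed (use Suc.prems that(1) step in auto)
    qed simp
    have "inj_on P.Q {1..istar}"
      by (rule linorder_inj_onI) (use mono in \<open>auto dest: less_imp_neq\<close>)
    then have card: "card (ext_vectors off) = istar"
      unfolding vec by (simp add: card_image)
    have line': "ext (line i) = P.Q i" if "1 \<le> i" for i
      using line[OF r, of i] that by (simp add: max_def)
    have img: "(\<lambda>i. ext (line i)) ` {1..istar} = P.Q ` {1..istar}"
      by (intro image_cong refl line') auto
    have big: "ext A = qtilde" if "A \<noteq> {}" "enat istar \<le> iota A" for A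
    proof (cases "iota A")
      case (enat i)
      then have "ext A = P.Q (max 1 i)" by (rule iotaE[OF r])
      also have "\<dots> = qtilde" using that enat by (simp add: Qge qt)
      finally show ?thesis .
    qed (use that iota_inf in auto)
    show "1 \<le> istar" "r ^ istar \<le> p" "finite (ext_vectors off)" "card (ext_vectors off) = istar"
      using istar card by (auto simp: vec)
    show "ext UNIV = qtilde" if "istar = 1"
      using univ[OF r] Qge[of 1] that by (simp add: qt)
    show "ext_vectors off = {qtilde}" if "istar = 1"
      using Qge[of 1] that by (simp add: vec qt)
    show "ext UNIV = ext (line 1)" by (simp add: univ[OF r] line')
    show "\<forall>i. 1 \<le> i \<and> i < istar \<longrightarrow> ext (line i) < ext (line (Suc i))"
      using step by (simp add: line')
    show "ext (line istar) = qtilde" using istar Qge[of istar] by (simp add: line' qt)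
    show "ext_vectors off = (\<lambda>i. ext (line i)) ` {1..istar}" by (simp only: img vec)
    show "\<forall>A i. iota A = enat i \<and> i < istar \<longrightarrow> ext A = ext (line i)"
      using iotaE[OF r] line[OF r] by simp
    show "\<forall>A. A \<noteq> {} \<and> enat istar \<le> iota A \<longrightarrow> ext A = qtilde"
      using big by blast
  next
    assume r1: "r = 1"
    then have r: "r \<le> 1" by simp
    have step: "P.Q i < P.Q (Suc i)" if "1 \<le> i" for i
      using that r1 assms(2) by (intro P.Q_strict) auto
    have line': "ext (line i) = P.Q i" if "1 \<le> i" for i
      using line[OF r, of i] that by (simp add: max_def)
    have img: "(\<lambda>i. ext (line i)) ` {1..} = P.Q ` {1..}"
      by (intro image_cong refl line') auto
    have "strict_mono (\<lambda>i. P.Q (Suc i))"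
      by (intro strict_mono_Suc_iff[THEN iffD2] allI step) simp
    then have "inj (\<lambda>i. P.Q (Suc i))" by (rule strict_mono_imp_inj_on)
    then have "infinite (range (\<lambda>i. P.Q (Suc i)))" by (rule range_inj_infinite)
    then have "infinite (ext_vectors off)"
      unfolding vectors[OF r] by (rule contrapos_nn) (erule finite_subset[rotated], auto)
    then show "infinite (ext_vectors off)" .
    show "countable (ext_vectors off)" by (simp add: vectors[OF r])
    show "ext UNIV = ext (line 1)" by (simp add: univ[OF r] line')
    show "\<forall>i\<ge>1. ext (line i) < ext (line (Suc i))" using step by (simp add: line')
    \<comment> \<open>Equality at \<open>i\<close> would put the strictly larger vector of line
      \<open>i + 1\<close> above \<open>qtilde\<close>, which bounds all of them.\<close>
    show "\<forall>i\<ge>1. ext (line i) \<noteq> qtilde"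
      using step P.Q_le_Qtilde by (metis line' qt leD)
    show "ext_vectors off = insert qtilde ((\<lambda>i. ext (line i)) ` {1..})"
      by (simp only: img vectors[OF r] qt)
    show "\<forall>A i. iota A = enat i \<longrightarrow> ext A = ext (line i)"
      using iotaE[OF r] line[OF r] by simp
    show "\<forall>A. A \<noteq> {} \<and> iota A = \<infinity> \<longrightarrow> ext A = qtilde"
      using iota_inf by blast
  next
    assume "1 < r"
    then show "uncountable (ext_vectors off)"
      unfolding off_def by (rule P.uncountable_ext_vectors)
  qed
qed

end
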